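(* Let $(B_t)$ be a standard Brownian motion in $\mathbb{R}^d$, $d\geq 1$, and let $f:[0,1]\to\mathbb{R}^d$ be a càdlàg function. Then for every non-empty subset $A$ of $[0,1]$ the following hold. (i) If $d=1$, then almost surely $$\underline{\dim}_M (B+f)(A) \geq \frac{2\,\underline{\dim}_M A}{\underline{\dim}_M A+1}\quad\text{and}\quad \overline{\dim}_M (B+f)(A) \geq \frac{2\,\overline{\dim}_M A}{\overline{\dim}_M A+1}.$$ The lower bounds can be achieved. (ii) If $d\geq 2$, then almost surely $$\underline{\dim}_M (B+f)(A) \geq 2\,\underline{\dim}_M A\quad\text{and}\quad \overline{\dim}_M (B+f)(A) \geq 2\,\overline{\dim}_M A.$$
   Context: For a function $h$ on $[0,1]$ and $A\subseteq[0,1]$, $h(A)=\{h(t):t\in A\}$ denotes the image; $(B+f)(t)=B_t+f(t)$. For a non-empty bounded set $E\subset\mathbb{R}^m$ and $\epsilon>0$, let $P(E,\epsilon)$ be the maximum number of pairwise disjoint balls of radius $\epsilon$ with centers in $E$. The upper and lower Minkowski (box) dimensions of $E$ are $$\overline{\dim}_M(E)=\limsup_{\epsilon\to 0}\frac{\log P(E,\epsilon)}{\log \epsilon^{-1}},\qquad \underline{\dim}_M(E)=\liminf_{\epsilon\to 0}\frac{\log P(E,\epsilon)}{\log \epsilon^{-1}}.$$ *)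

theory Defs
  imports "HOL-Probability.Probability"
begin

text \<open>
  Distinct elements of the set S index distinct balls. For non-empty bounded E in a Euclidean
  space and e > 0 the set of cardinalities is finite and non-empty, so the maximum exists; for
  other arguments the value is unspecified. With open balls, disjointness of two balls in
  Euclidean space means that their centres are at distance at least 2 * e.
\<close>

definition packing_number :: "'a::metric_space set \<Rightarrow> real \<Rightarrow> nat" where
  "packing_number E e =
     Max {card S | S. S \<subseteq> E \<and> finite S \<and> disjoint_family_on (\<lambda>x. ball x e) S}"

definition upper_minkowski_dim :: "'a::metric_space set \<Rightarrow> ereal" where
  "upper_minkowski_dim E =
     Limsup (at_right 0) (\<lambda>e. ereal (ln (real (packing_number E e)) / ln (1 / e)))"

definition lower_minkowski_dim :: "'a::metric_space set \<Rightarrow> ereal" where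
  "lower_minkowski_dim E =
     Liminf (at_right 0) (\<lambda>e. ereal (ln (real (packing_number E e)) / ln (1 / e)))"

text \<open>Values of f outside the unit interval are irrelevant.\<close>

definition cadlag :: "(real \<Rightarrow> 'a::topological_space) \<Rightarrow> bool" where
  "cadlag f \<longleftrightarrow>
     (\<forall>t\<in>{0..<1}. (f \<longlongrightarrow> f t) (at_right t)) \<and>
     (\<forall>t\<in>{0<..1}. \<exists>l. (f \<longlongrightarrow> l) (at_left t))"

text \<open>
  The density below is that of the centred Gaussian law with covariance matrix (t - s) I;
  the second parameter of \<^const>\<open>normal_density\<close> is the standard deviation.
\<close>

locale standard_brownian_motion = prob_space M for M :: "'w measure" +
  fixes B :: "real \<Rightarrow> 'w \<Rightarrow> real ^ 'd"
  assumes measurable_B: "\<And>t. 0 \<le> t \<Longrightarrow> B t \<in> borel_measurable M"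
    and start_zero: "AE \<omega> in M. B 0 \<omega> = 0"
    and independent_increments:
      "\<And>(n::nat) (t :: nat \<Rightarrow> real). 0 \<le> t 0 \<Longrightarrow> (\<And>i. i < n \<Longrightarrow> t i < t (Suc i)) \<Longrightarrow>
         indep_vars (\<lambda>_. borel) (\<lambda>i \<omega>. B (t (Suc i)) \<omega> - B (t i) \<omega>) {..<n}"
    and gaussian_increments:
      "\<And>s t. 0 \<le> s \<Longrightarrow> s < t \<Longrightarrow>
         distributed M lborel (\<lambda>\<omega>. B t \<omega> - B s \<omega>)
           (\<lambda>x. ennreal (\<Prod>i\<in>UNIV. normal_density 0 (sqrt (t - s)) (x $ i)))"
    and continuous_paths: "AE \<omega> in M. continuous_on {0..} (\<lambda>t. B t \<omega>)"

end

theory Submission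
  imports Defs "HOL-Real_Asymp.Real_Asymp"
begin

text \<open>
  Lower bounds: take about r powr (-a) points of A at mutual distance at least 2 r. The Gaussian
  density makes two of their images closer than \<rho> with probability at most
  (\<rho> powr 2 / |s - t|) powr q whenever 2 q \<le> d, whatever f is. Summing over pairs, the expected number
  of close pairs is of smaller order than the number of points as soon as \<rho> = r powr \<kappa> with
  2 \<kappa> > 1 + a (1 - q) / q; Markov's inequality and Borel-Cantelli along r = 2 powr (-m) then give
  dimension at least a / \<kappa>. For d = 1 take q = 1/2, for d \<ge> 2 let q tend to 1.

  Sharpness for d = 1: with f = 0 and A the points n powr (-p), 1 + p = 1 / \<alpha>, cover the images of
  the first m points one by one and the others by an interval of length about m powr (-p/2),
  and optimise over m.
\<close>

section \<open>Packing numbers and Minkowski dimensions\<close>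

text \<open>The critical \<open>\<kappa>\<close> comes from a balance. Each of the N = r powr (-a)
  points meets an energy sum of order r powr (-q) * N powr (1 - q), which the Gaussian factor \<rho>
  powr (2 q) has to beat, so 2 q \<kappa> - q - a (1 - q) must be positive. The constant 1 / (1 - q)
  of the energy sum forces q < 1, and d coordinates of the density allow at most q = d / 2. Hence q
  = 1/2 gives a / \<kappa> arbitrarily close to 2 a / (1 + a), and q near 1 gives a / \<kappa>
  arbitrarily close to 2 a.

  The function f only translates each increment, and the Gaussian density is bounded uniformly in
  the centre of the ball. Regularity of f serves to keep the image bounded, since
  \<open>packing_number\<close> is unspecified on unbounded sets.

  One exceptional event per scale serves both dimensions: almost surely all large scales are good,
  and a good scale transfers many points of A to the image, whether A has them eventually or only
  infinitely often.

  For sharpness, m + m powr (-p/2) / e balances at m = e powr (-1 / (1 + p/2)), and 1 / (1 + p/2) =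
  2 \<alpha> / (\<alpha> + 1).\<close>

lemma finite_packing_cards:
  fixes E :: "'a::euclidean_space set"
  assumes "bounded E" "0 < e"
  shows "finite {card S | S. S \<subseteq> E \<and> finite S \<and> disjoint_family_on (\<lambda>x. ball x e) S}"
proof -
  have "compact (closure E)" using assms by simp
  then obtain k where k: "finite k" "closure E \<subseteq> (\<Union>x\<in>k. ball x e)"
    using assms(2) unfolding compact_eq_totally_bounded by blast
  \<comment> \<open>Send each point of \<open>S\<close> to a nearby point of the finite net
    \<open>k\<close>. Two points with the same net point would have balls that both contain
    it.\<close>
  have "card S \<le> card k"
    if S: "S \<subseteq> E" "finite S" "disjoint_family_on (\<lambda>x. ball x e) S" for S
  proof -
    have "\<forall>x\<in>S. \<exists>c\<in>k. dist c x < e"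
      using S(1) k(2) closure_subset[of E] by force
    then obtain c where c: "\<And>x. x \<in> S \<Longrightarrow> c x \<in> k \<and> dist (c x) x < e" by metis
    have "inj_on c S"
    proof (rule inj_onI, rule ccontr)
      fix x y assume xy: "x \<in> S" "y \<in> S" "c x = c y" "x \<noteq> y"
      have "dist (c x) x < e" using c[OF xy(1)] by blast
      moreover have "dist (c x) y < e" using c[OF xy(2)] xy(3) by simp
      ultimately have "c x \<in> ball x e \<inter> ball y e" by (simp add: dist_commute)
      moreover have "ball x e \<inter> ball y e = {}"
        using S(3) xy(1,2,4) unfolding disjoint_family_on_def by blast
      ultimately show False by blast
    qed
    then show ?thesis using c k(1) by (intro card_inj_on_le[of c]) auto
  qed
  then have "{card S | S. S \<subseteq> E \<and> finite S \<and> disjoint_family_on (\<lambda>x. ball x e) S} \<subseteq> {..card k}"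
    by auto
  then show ?thesis using finite_subset by blast
qed

text \<open>The midpoint of the centres is the witness that two balls meet. This replaces the
  disjoint balls of the definition by separated points, the form used from here on.\<close>

lemma disjoint_balls_iff:
  fixes x y :: "'a::real_normed_vector"
  assumes "0 < e"
  shows "ball x e \<inter> ball y e = {} \<longleftrightarrow> 2 * e \<le> dist x y"
proof
  assume "ball x e \<inter> ball y e = {}"
  show "2 * e \<le> dist x y"
  proof (rule ccontr)
    assume "\<not> ?thesis"
    then have "midpoint x y \<in> ball x e \<inter> ball y e"
      by (auto simp: dist_midpoint mem_ball)
    then show False using \<open>_ = {}\<close> by blast
  qed
next
  assume "2 * e \<le> dist x y"
  then show "ball x e \<inter> ball y e = {}" by (intro disjoint_ballI) simp
qed

lemma packing_number_ge:
  fixes E :: "'a::euclidean_space set"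
  assumes "bounded E" "0 < e" "S \<subseteq> E" "finite S"
    and "\<And>x y. x \<in> S \<Longrightarrow> y \<in> S \<Longrightarrow> x \<noteq> y \<Longrightarrow> 2 * e \<le> dist x y"
  shows "card S \<le> packing_number E e"
proof -
  have "disjoint_family_on (\<lambda>x. ball x e) S"
    using assms by (auto simp only: disjoint_family_on_def disjoint_balls_iff)
  with assms(3,4) have "card S \<in> {card S | S. S \<subseteq> E \<and> finite S \<and> disjoint_family_on (\<lambda>x. ball x e) S}"
    by blast
  then show ?thesis unfolding packing_number_def
    by (rule Max_ge[OF finite_packing_cards[OF assms(1,2)]])
qed

lemma packing_number_attained:
  fixes E :: "'a::euclidean_space set"
  assumes "bounded E" "0 < e"
  obtains S where "S \<subseteq> E" "finite S" "card S = packing_number E e"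
    "\<And>x y. x \<in> S \<Longrightarrow> y \<in> S \<Longrightarrow> x \<noteq> y \<Longrightarrow> 2 * e \<le> dist x y"
proof -
  let ?C = "{card S | S. S \<subseteq> E \<and> finite S \<and> disjoint_family_on (\<lambda>x. ball x e) S}"
  have "card {} \<in> ?C"
    unfolding mem_Collect_eq by (rule exI[of _ "{}"]) (simp add: disjoint_family_on_def)
  then have "packing_number E e \<in> ?C"
    unfolding packing_number_def using finite_packing_cards[OF assms] by (intro Max_in) auto
  then obtain S where S: "S \<subseteq> E" "finite S" "card S = packing_number E e"
    "disjoint_family_on (\<lambda>x. ball x e) S" by (auto simp: eq_commute)
  show thesis
    by (rule that[OF S(1-3)])
       (use S(4) in \<open>auto simp: disjoint_family_on_def disjoint_balls_iff[OF assms(2), symmetric]\<close>)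
qed

lemma packing_number_antimono:
  fixes E :: "'a::euclidean_space set"
  assumes "bounded E" "0 < e" "e \<le> e'"
  shows "packing_number E e' \<le> packing_number E e"
proof -
  obtain S where S: "S \<subseteq> E" "finite S" "card S = packing_number E e'"
    "\<And>x y. x \<in> S \<Longrightarrow> y \<in> S \<Longrightarrow> x \<noteq> y \<Longrightarrow> 2 * e' \<le> dist x y"
    using packing_number_attained[of E e'] assms by auto
  have "2 * e \<le> dist x y" if "x \<in> S" "y \<in> S" "x \<noteq> y" for x y
    using S(4)[OF that] assms(3) by linarith
  with assms(1,2) S(1,2) have "card S \<le> packing_number E e"
    by (rule packing_number_ge)
  then show ?thesis using S(3) by simp
qed

lemma packing_number_pos:
  fixes E :: "'a::euclidean_space set"
  assumes "bounded E" "0 < e" "E \<noteq> {}"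
  shows "1 \<le> packing_number E e"
proof -
  obtain x where "x \<in> E" using assms by blast
  then have "card {x} \<le> packing_number E e"
    using assms by (intro packing_number_ge) auto
  then show ?thesis by simp
qed

lemma lower_minkowski_dim_le_upper: "lower_minkowski_dim E \<le> upper_minkowski_dim E"
  unfolding lower_minkowski_dim_def upper_minkowski_dim_def
  by (intro Liminf_le_Limsup) simp

lemma lower_minkowski_dim_nonneg:
  fixes E :: "'a::euclidean_space set"
  assumes "bounded E" "E \<noteq> {}"
  shows "0 \<le> lower_minkowski_dim E"
  unfolding lower_minkowski_dim_def
proof (rule Liminf_bounded)
  have "\<forall>\<^sub>F e in at_right 0. e \<in> {0<..<1::real}"
    by (rule eventually_at_right_real) simp
  then show "\<forall>\<^sub>F e in at_right 0. 0 \<le> ereal (ln (real (packing_number E e)) / ln (1 / e))"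
  proof eventually_elim
    case (elim e)
    then have "1 \<le> real (packing_number E e)" using packing_number_pos[OF assms(1) _ assms(2), of e] by simp
    then show ?case using elim by (auto intro!: divide_nonneg_pos)
  qed
qed


section \<open>Minkowski dimensions read off along geometric sequences of scales\<close>

lemma packing_number_exponent_less_iff:
  fixes E :: "'a::euclidean_space set"
  assumes "bounded E" "E \<noteq> {}" "0 < e" "e < 1"
  shows "ereal a < ereal (ln (real (packing_number E e)) / ln (1 / e))
           \<longleftrightarrow> (1 / e) powr a < real (packing_number E e)"
proof -
  have pos: "0 < real (packing_number E e)" using packing_number_pos[OF assms(1,3,2)] by simp
  have "a < ln (real (packing_number E e)) / ln (1 / e)
      \<longleftrightarrow> a * ln (1 / e) < ln (real (packing_number E e))"
    using assms(3,4) by (intro pos_less_divide_eq) simp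
  also have "\<dots> \<longleftrightarrow> exp (a * ln (1 / e)) < exp (ln (real (packing_number E e)))"
    by (rule exp_less_cancel_iff[symmetric])
  also have "\<dots> \<longleftrightarrow> (1 / e) powr a < real (packing_number E e)"
    using pos assms(3) by (simp add: powr_def)
  finally show ?thesis by simp
qed

lemma eventually_packing_number_dyadic:
  fixes E :: "'a::euclidean_space set"
  assumes "bounded E" "E \<noteq> {}" "ereal a < lower_minkowski_dim E"
  shows "\<forall>\<^sub>F m in sequentially. 2 powr (a * real m) \<le> real (packing_number E (2 powr - real m))"
proof -
  have "\<forall>\<^sub>F e in at_right 0. ereal a < ereal (ln (real (packing_number E e)) / ln (1 / e))"
    using less_LiminfD assms(3) unfolding lower_minkowski_dim_def by blast
  moreover have "\<forall>\<^sub>F e in at_right 0. e \<in> {0<..<1::real}"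
    by (rule eventually_at_right_real) simp
  ultimately have "\<forall>\<^sub>F e in at_right 0. (1 / e) powr a < real (packing_number E e)"
    by eventually_elim (use packing_number_exponent_less_iff[OF assms(1,2)] in auto)
  moreover have "filterlim (\<lambda>m. 2 powr - real m) (at_right 0) sequentially"
    by real_asymp
  ultimately have "\<forall>\<^sub>F m in sequentially.
      (1 / 2 powr - real m) powr a < real (packing_number E (2 powr - real m))"
    by (rule eventually_compose_filterlim)
  then show ?thesis
    by eventually_elim (simp add: powr_minus_divide powr_powr mult.commute)
qed

text \<open>A scale e witnessing the limit superior need not be dyadic. Rounding log 2 (1 / e) up to
  an integer can only increase the packing number and costs at most one unit in the exponent, which
  the gap between \<open>a\<close> and an intermediate \<open>b\<close> absorbs.\<close>

lemma frequently_packing_number_dyadic: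
  fixes E :: "'a::euclidean_space set"
  assumes "bounded E" "E \<noteq> {}" "ereal a < upper_minkowski_dim E" "0 \<le> a"
  shows "\<exists>\<^sub>F m in sequentially. 2 powr (a * real m) \<le> real (packing_number E (2 powr - real m))"
proof -
  obtain b where b: "ereal a < ereal b" "ereal b < upper_minkowski_dim E"
    using ereal_dense2[OF assms(3)] by blast
  have freq: "\<exists>\<^sub>F e in at_right 0. ereal b < ereal (ln (real (packing_number E e)) / ln (1 / e))"
  proof (rule ccontr)
    assume "\<not> ?thesis"
    then have "upper_minkowski_dim E \<le> ereal b"
      unfolding upper_minkowski_dim_def
      by (intro Limsup_bounded) (simp add: not_frequently not_less)
    then show False using b by simp
  qed
  show ?thesis
    unfolding frequently_def eventually_sequentially
  proof clarify
    fix M assume M: "\<forall>m\<ge>M. \<not> 2 powr (a * real m) \<le> real (packing_number E (2 powr - real m))"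
    \<comment> \<open>The first bound puts the rounded index \<open>m\<close> into the range of
      \<open>M\<close>; the second is what a * m \<le> b * (m - 1), the price of rounding,
      requires.\<close>
    define L where "L = max (real M) (b / (b - a))"
    have "\<forall>\<^sub>F e in at_right 0. e \<in> {0<..<2 powr - L}"
      by (rule eventually_at_right_real) simp
    from frequently_ex[OF frequently_eventually_frequently[OF freq this]]
    obtain e where e: "0 < e" "e < 2 powr - L"
      "ereal b < ereal (ln (real (packing_number E e)) / ln (1 / e))"
      by auto
    define l where "l = log 2 (1 / e)"
    have e_eq: "e = 2 powr - l" unfolding l_def using e(1) by (simp add: powr_minus powr_log_cancel log_divide)
    have "L < l" using e(2) unfolding e_eq by simp
    have "0 \<le> L" unfolding L_def by simp
    define m where "m = nat \<lceil>l\<rceil>"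
    have m: "l \<le> m" "m < l + 1" unfolding m_def using \<open>L < l\<close> \<open>0 \<le> L\<close> by linarith+
    have "e < 1" unfolding e_eq using \<open>L < l\<close> \<open>0 \<le> L\<close> powr_less_mono[of "- l" 0 2] by simp
    have "a < b" using b by simp
    have "b / (b - a) \<le> m" using m \<open>L < l\<close> unfolding L_def by simp
    then have "a * m \<le> b * (real m - 1)" using \<open>a < b\<close> by (simp add: field_simps)
    also have "\<dots> \<le> b * l" using m \<open>a < b\<close> assms(4) by (intro mult_left_mono) auto
    finally have "2 powr (a * m) \<le> 2 powr (b * l)" by simp
    also have "\<dots> = (1 / e) powr b" unfolding e_eq by (simp add: powr_minus_divide powr_powr mult.commute)
    also have "\<dots> \<le> real (packing_number E e)"
      using packing_number_exponent_less_iff[OF assms(1,2) e(1) \<open>e < 1\<close>] e(3) by simp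
    also have "\<dots> \<le> real (packing_number E (2 powr - real m))"
      using m by (intro of_nat_mono packing_number_antimono assms(1)) (auto simp: e_eq)
    finally show False using M m \<open>L < l\<close> unfolding L_def by auto
  qed
qed

text \<open>Any small e is compared with the next coarser scale 2 powr - (k * m), whose packing
  number is no larger. This loses at most a factor 2 powr a, and constant factors vanish after
  division by ln (1 / e).\<close>

lemma lower_minkowski_dim_geI:
  fixes E :: "'a::euclidean_space set"
  assumes "bounded E" "E \<noteq> {}" "0 < c" "0 \<le> a" "0 < k"
    and ev: "\<forall>\<^sub>F m in sequentially. c * 2 powr (a * real m) \<le> real (packing_number E (2 powr - (k * real m)))"
  shows "ereal (a / k) \<le> lower_minkowski_dim E"
proof -
  obtain M where M: "\<And>m. m \<ge> M \<Longrightarrow>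
      c * 2 powr (a * real m) \<le> real (packing_number E (2 powr - (k * real m)))"
    using ev unfolding eventually_sequentially by blast
  \<comment> \<open>This is ln (c * 2 powr (a * (l / k - 1))) / ln (1 / e) with l = log 2 (1 / e):
    the assumed bound after \<open>m\<close> is replaced by its lower estimate l / k - 1.\<close>
  let ?h = "\<lambda>e. a / k + (ln c - a * ln 2) / ln (1 / e)"
  have "((\<lambda>e. ereal (?h e)) \<longlongrightarrow> ereal (a / k)) (at_right 0)"
    by (intro tendsto_ereal) real_asymp
  then have "ereal (a / k) = Liminf (at_right 0) (\<lambda>e. ereal (?h e))"
    by (intro lim_imp_Liminf[symmetric]) simp_all
  also have "\<dots> \<le> lower_minkowski_dim E"
    unfolding lower_minkowski_dim_def
  proof (rule Liminf_mono)
    have "\<forall>\<^sub>F e in at_right 0. e \<in> {0<..<2 powr - (k * (real M + 1))}"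
      by (rule eventually_at_right_real) simp
    then show "\<forall>\<^sub>F e in at_right 0. ereal (?h e) \<le> ereal (ln (real (packing_number E e)) / ln (1 / e))"
    proof eventually_elim
      case (elim e)
      define l where "l = log 2 (1 / e)"
      have e_eq: "e = 2 powr - l" unfolding l_def using elim by (simp add: powr_minus powr_log_cancel log_divide)
      have l: "k * (real M + 1) < l" using elim unfolding e_eq by simp
      have "0 < l" by (rule le_less_trans[OF _ l]) (use assms in simp)
      define m where "m = nat \<lfloor>l / k\<rfloor>"
      have "real M + 1 < l / k" using l assms by (simp add: field_simps)
      then have m: "m \<le> l / k" "l / k < m + 1" "M \<le> m" unfolding m_def by linarith+
      have "c * 2 powr (a * (l / k - 1)) \<le> c * 2 powr (a * m)"
        using m assms by (intro mult_left_mono powr_mono mult_left_mono) auto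
      also have "\<dots> \<le> real (packing_number E (2 powr - (k * real m)))" using M m by auto
      also have "\<dots> \<le> real (packing_number E e)"
        using m elim assms by (intro of_nat_mono packing_number_antimono) (auto simp: e_eq field_simps)
      finally have *: "c * 2 powr (a * (l / k - 1)) \<le> real (packing_number E e)" .
      have "ln c + a * (l / k - 1) * ln 2 = ln (c * 2 powr (a * (l / k - 1)))"
        using assms by (simp add: ln_mult ln_powr)
      also have "\<dots> \<le> ln (real (packing_number E e))"
        using * assms by (intro ln_mono) (auto intro: less_le_trans[OF _ *])
      finally have **: "ln c + a * (l / k - 1) * ln 2 \<le> ln (real (packing_number E e))" .
      have ln_e: "ln (1 / e) = l * ln 2" unfolding e_eq by (simp add: ln_powr powr_minus_divide)
      have "?h e = (ln c + a * (l / k - 1) * ln 2) / ln (1 / e)"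
        unfolding ln_e using \<open>0 < l\<close> assms by (simp add: field_simps)
      also have "\<dots> \<le> ln (real (packing_number E e)) / ln (1 / e)"
        using ** \<open>0 < l\<close> by (intro divide_right_mono) (auto simp: ln_e)
      finally show ?case by simp
    qed
  qed
  finally show ?thesis .
qed

text \<open>One sequence of scales tending to 0 bounds a limit superior from below, so no
  interpolation between scales occurs; \<open>c\<close> contributes a term of order 1 / m.\<close>

lemma upper_minkowski_dim_geI:
  fixes E :: "'a::euclidean_space set"
  assumes "0 < c" "0 < k"
    and freq: "\<exists>\<^sub>F m in sequentially. c * 2 powr (a * real m) \<le> real (packing_number E (2 powr - (k * real m)))"
  shows "ereal (a / k) \<le> upper_minkowski_dim E"
proof (rule ccontr)
  assume "\<not> ?thesis"
  then obtain y where y: "upper_minkowski_dim E < ereal y" "ereal y < ereal (a / k)"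
    using ereal_dense2 by (meson not_le)
  have "\<forall>\<^sub>F e in at_right 0. ereal (ln (real (packing_number E e)) / ln (1 / e)) < ereal y"
    using y(1) Limsup_lessD unfolding upper_minkowski_dim_def by blast
  moreover have "filterlim (\<lambda>m. 2 powr - (k * real m)) (at_right 0) sequentially"
    using assms(2) by real_asymp
  ultimately have 1: "\<forall>\<^sub>F m in sequentially. ereal (ln (real (packing_number E (2 powr - (k * real m))))
      / ln (1 / (2 powr - (k * real m)))) < ereal y"
    by (rule eventually_compose_filterlim)
  have "((\<lambda>m. a / k + (ln c / (k * ln 2)) / real m) \<longlongrightarrow> a / k) sequentially"
    by real_asymp
  then have 2: "\<forall>\<^sub>F m in sequentially. y < a / k + (ln c / (k * ln 2)) / real m"
    using y(2) by (intro order_tendstoD(1)) auto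
  have "\<forall>\<^sub>F m in sequentially.
      \<not> c * 2 powr (a * real m) \<le> real (packing_number E (2 powr - (k * real m)))"
    using 1 2 eventually_gt_at_top[of 0]
  proof eventually_elim
    case (elim m)
    show ?case
    proof
      assume *: "c * 2 powr (a * real m) \<le> real (packing_number E (2 powr - (k * real m)))"
      have "ln c + a * real m * ln 2 = ln (c * 2 powr (a * real m))"
        using assms by (simp add: ln_mult ln_powr)
      also have "\<dots> \<le> ln (real (packing_number E (2 powr - (k * real m))))"
        using * assms by (intro ln_mono) (auto intro: less_le_trans[OF _ *])
      finally have "(ln c + a * real m * ln 2) / (k * real m * ln 2)
          \<le> ln (real (packing_number E (2 powr - (k * real m)))) / (k * real m * ln 2)"
        using assms by (intro divide_right_mono) auto
      also have "(ln c + a * real m * ln 2) / (k * real m * ln 2) = a / k + (ln c / (k * ln 2)) / real m"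
        using elim assms by (simp add: field_simps)
      also have "k * real m * ln 2 = ln (1 / (2 powr - (k * real m)))"
        by (simp add: ln_powr powr_minus_divide)
      finally show False using elim by simp
    qed
  qed
  then show False using freq by (simp add: frequently_def)
qed

lemma upper_minkowski_dim_leI:
  fixes E :: "'a::euclidean_space set"
  assumes "bounded E" "E \<noteq> {}" "0 < c"
    and bd: "\<And>e. 0 < e \<Longrightarrow> e < 1 \<Longrightarrow> real (packing_number E e) \<le> c * (1 / e) powr b"
  shows "upper_minkowski_dim E \<le> ereal b"
proof -
  let ?h = "\<lambda>e. b + ln c / ln (1 / e)"
  have "((\<lambda>e. ereal (?h e)) \<longlongrightarrow> ereal b) (at_right 0)"
    by (intro tendsto_ereal) real_asymp
  then have "ereal b = Limsup (at_right 0) (\<lambda>e. ereal (?h e))"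
    by (intro lim_imp_Limsup[symmetric]) simp_all
  moreover have "upper_minkowski_dim E \<le> Limsup (at_right 0) (\<lambda>e. ereal (?h e))"
    unfolding upper_minkowski_dim_def
  proof (rule Limsup_mono)
    have "\<forall>\<^sub>F e in at_right 0. e \<in> {0<..<1::real}"
      by (rule eventually_at_right_real) simp
    then show "\<forall>\<^sub>F e in at_right 0. ereal (ln (real (packing_number E e)) / ln (1 / e)) \<le> ereal (?h e)"
    proof eventually_elim
      case (elim e)
      have pos: "0 < real (packing_number E e)"
        using packing_number_pos[OF assms(1) _ assms(2), of e] elim by simp
      have "0 < ln (1 / e)" using elim by simp
      have "ln (real (packing_number E e)) \<le> ln (c * (1 / e) powr b)"
        using bd[of e] elim pos by (intro ln_mono) auto
      also have "\<dots> = ln c + b * ln (1 / e)"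
        using elim assms by (simp add: ln_mult ln_powr)
      finally have "ln (real (packing_number E e)) / ln (1 / e) \<le> (ln c + b * ln (1 / e)) / ln (1 / e)"
        using \<open>0 < ln (1 / e)\<close> by (intro divide_right_mono) auto
      also have "\<dots> = ?h e" using \<open>0 < ln (1 / e)\<close> by (simp only: add_divide_distrib) simp
      finally show ?case by simp
    qed
  qed
  ultimately show ?thesis by simp
qed

section \<open>Close pairs in the image of a separated set\<close>

lemma sum_powr_minus_le:
  fixes q :: real
  assumes "0 < q" "q < 1"
  shows "(\<Sum>k=1..n. real k powr - q) \<le> real n powr (1 - q) / (1 - q)"
proof (induction n)
  case (Suc n)
  have "real n powr (1 - q) \<le> (real n + q) * real (Suc n) powr - q"
  proof (cases "n = 0")
    case False
    \<comment> \<open>Young's inequality with weights 1 - q and q replaces the comparison with an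
      integral: it says that x powr (1 - q) / (1 - q) grows from n to n + 1 by at least the new
      summand.\<close>
    have "real n powr (1 - q) * real (Suc n) powr q \<le> (1 - q) * real n + q * real (Suc n)"
      using False assms by (intro Youngs_inequality_0) auto
    also have "\<dots> = real n + q" by (simp add: algebra_simps)
    finally have "real n powr (1 - q) * real (Suc n) powr q * real (Suc n) powr - q
        \<le> (real n + q) * real (Suc n) powr - q"
      by (intro mult_right_mono) auto
    then show ?thesis by (simp add: mult.assoc flip: powr_add)
  qed (use assms in simp)
  also have "\<dots> = (real (Suc n) - (1 - q)) * real (Suc n) powr - q" by simp
  also have "\<dots> = real (Suc n) powr (1 - q) - (1 - q) * real (Suc n) powr - q"
    using powr_add[of "real (Suc n)" 1 "- q"] by (simp add: algebra_simps)
  finally have "(real n powr (1 - q) + (1 - q) * real (Suc n) powr - q) / (1 - q)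
      \<le> real (Suc n) powr (1 - q) / (1 - q)"
    using assms by (intro divide_right_mono) auto
  then have "real n powr (1 - q) / (1 - q) + real (Suc n) powr - q \<le> real (Suc n) powr (1 - q) / (1 - q)"
    using assms by (simp add: add_divide_distrib)
  then show ?case using Suc by simp
qed simp

text \<open>The j-th smallest element of \<open>F\<close> is at least j. Induction adds the largest
  element \<open>b\<close>, whose predecessors all lie in {1..<b}, so b exceeds their
  number.\<close>

lemma sum_antimono_le_sum_initial:
  fixes g :: "nat \<Rightarrow> real"
  assumes "finite F" "\<And>k. k \<in> F \<Longrightarrow> 1 \<le> k"
    and g: "\<And>j k. 1 \<le> j \<Longrightarrow> j \<le> k \<Longrightarrow> g k \<le> g j"
  shows "sum g F \<le> sum g {1..card F}"
  using assms(1,2)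
proof (induction F rule: finite_linorder_max_induct)
  case (insert b A)
  have "A \<subseteq> {1..<b}" using insert by auto
  then have "card A \<le> b - 1" using card_mono[of "{1..<b}" A] by simp
  then have "g b \<le> g (Suc (card A))" using insert.prems[of b] by (intro g) auto
  moreover have "b \<notin> A" using insert by auto
  ultimately show ?case using insert by (simp add: add.commute add_mono)
qed simp

text \<open>Rounding down to multiples of \<open>\<delta>\<close> turns \<open>U\<close> into
  distinct positive integers: distinct by separation, positive because every element is at least
  \<open>\<delta>\<close>. The sum is then largest for an initial segment. The free bound
  \<open>n\<close> lets each half of a larger set be estimated by the size of the whole.\<close>

lemma sum_powr_minus_separated_pos:
  fixes U :: "real set"
  assumes q: "0 < q" "q < 1" and U: "finite U" "0 < \<delta>" "\<And>u. u \<in> U \<Longrightarrow> \<delta> \<le> u" "card U \<le> n"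
    and sep: "\<And>u v. u \<in> U \<Longrightarrow> v \<in> U \<Longrightarrow> u \<noteq> v \<Longrightarrow> \<delta> \<le> dist u v"
  shows "(\<Sum>u\<in>U. u powr - q) \<le> \<delta> powr - q * (real n powr (1 - q) / (1 - q))"
proof -
  define k where "k u = nat \<lfloor>u / \<delta>\<rfloor>" for u
  have k: "1 \<le> k u" "\<delta> * k u \<le> u" "u < \<delta> * (real (k u) + 1)" if "u \<in> U" for u
  proof -
    have *: "1 \<le> u / \<delta>" using U(2) U(3)[OF that] by simp
    then show "1 \<le> k u" unfolding k_def by linarith
    have "real (k u) = of_int \<lfloor>u / \<delta>\<rfloor>" unfolding k_def using * by simp
    then have "k u \<le> u / \<delta>" "u / \<delta> < k u + 1" by linarith+
    then show "\<delta> * k u \<le> u" "u < \<delta> * (real (k u) + 1)"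
      using U(2) by (simp_all add: field_simps)
  qed
  have inj: "inj_on k U"
  proof (rule inj_onI, rule ccontr)
    fix u v assume *: "u \<in> U" "v \<in> U" "k u = k v" "u \<noteq> v"
    have "\<bar>u - v\<bar> < \<delta>"
      using k(2,3)[OF *(1)] k(2,3)[OF *(2)] unfolding *(3) by (simp add: algebra_simps)
    then show False using sep[OF *(1,2,4)] by (simp add: dist_real_def)
  qed
  have "(\<Sum>u\<in>U. u powr - q) \<le> (\<Sum>u\<in>U. \<delta> powr - q * real (k u) powr - q)"
  proof (rule sum_mono)
    fix u assume u: "u \<in> U"
    have "u powr - q \<le> (\<delta> * k u) powr - q"
      using k[OF u] U(2) q by (intro powr_mono2') auto
    then show "u powr - q \<le> \<delta> powr - q * real (k u) powr - q"
      using U(2) by (simp add: powr_mult)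
  qed
  also have "\<dots> = \<delta> powr - q * (\<Sum>j\<in>k ` U. real j powr - q)"
    by (simp add: sum.reindex[OF inj] sum_distrib_left)
  also have "(\<Sum>j\<in>k ` U. real j powr - q) \<le> (\<Sum>j=1..card (k ` U). real j powr - q)"
    using U k q by (intro sum_antimono_le_sum_initial powr_mono2') auto
  also have "\<dots> \<le> (\<Sum>j=1..n. real j powr - q)"
    using U(4) card_image[OF inj] by (intro sum_mono2) auto
  also have "\<dots> \<le> real n powr (1 - q) / (1 - q)"
    by (rule sum_powr_minus_le[OF q])
  finally show ?thesis by (simp add: mult_left_mono)
qed

text \<open>On either side of \<open>s\<close> the map t to |t - s| is an isometry, so the distances
  are themselves separated; the two sides give the factor 2.\<close>

lemma sum_powr_minus_separated:
  fixes T :: "real set"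
  assumes q: "0 < q" "q < 1" and T: "finite T" "0 < \<delta>" "s \<in> T"
    and sep: "\<And>u v. u \<in> T \<Longrightarrow> v \<in> T \<Longrightarrow> u \<noteq> v \<Longrightarrow> \<delta> \<le> dist u v"
  shows "(\<Sum>t\<in>T - {s}. \<bar>t - s\<bar> powr - q) \<le> 2 * \<delta> powr - q * (real (card T) powr (1 - q) / (1 - q))"
proof -
  have half: "(\<Sum>t\<in>V. \<bar>t - s\<bar> powr - q) \<le> \<delta> powr - q * (real (card T) powr (1 - q) / (1 - q))"
    if V: "V \<subseteq> T - {s}" "inj_on (\<lambda>t. \<bar>t - s\<bar>) V"
      "\<And>u v. u \<in> V \<Longrightarrow> v \<in> V \<Longrightarrow> dist \<bar>u - s\<bar> \<bar>v - s\<bar> = dist u v" for V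
  proof -
    have "finite V" using V(1) T(1) finite_subset by blast
    have "card V \<le> card T" using V(1) T(1) by (intro card_mono) auto
    have "(\<Sum>u\<in>(\<lambda>t. \<bar>t - s\<bar>) ` V. u powr - q) \<le> \<delta> powr - q * (real (card T) powr (1 - q) / (1 - q))"
    proof (rule sum_powr_minus_separated_pos[OF q _ T(2)])
      show "finite ((\<lambda>t. \<bar>t - s\<bar>) ` V)" using \<open>finite V\<close> by simp
      show "card ((\<lambda>t. \<bar>t - s\<bar>) ` V) \<le> card T"
        using \<open>card V \<le> card T\<close> card_image[OF V(2)] by simp
      show "\<delta> \<le> u" if "u \<in> (\<lambda>t. \<bar>t - s\<bar>) ` V" for u
        using that V(1) sep[OF _ T(3)] by (auto simp: dist_real_def)
      show "\<delta> \<le> dist u v" if uv: "u \<in> (\<lambda>t. \<bar>t - s\<bar>) ` V" "v \<in> (\<lambda>t. \<bar>t - s\<bar>) ` V" "u \<noteq> v" for u v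
      proof -
        obtain t t' where t: "t \<in> V" "t' \<in> V" "u = \<bar>t - s\<bar>" "v = \<bar>t' - s\<bar>"
          using uv by blast
        with V(1) V(3)[OF t(1,2)] sep[of t t'] uv(3) show ?thesis by auto
      qed
    qed
    then show ?thesis by (simp add: sum.reindex[OF V(2)])
  qed
  have split: "T - {s} = {t \<in> T. s < t} \<union> {t \<in> T. t < s}" by auto
  have "(\<Sum>t\<in>T - {s}. \<bar>t - s\<bar> powr - q)
      = (\<Sum>t\<in>{t \<in> T. s < t}. \<bar>t - s\<bar> powr - q) + (\<Sum>t\<in>{t \<in> T. t < s}. \<bar>t - s\<bar> powr - q)"
    unfolding split using T(1) by (intro sum.union_disjoint) auto
  also have "\<dots> \<le> \<delta> powr - q * (real (card T) powr (1 - q) / (1 - q))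
      + \<delta> powr - q * (real (card T) powr (1 - q) / (1 - q))"
    by (intro add_mono half) (auto simp: inj_on_def dist_real_def)
  finally show ?thesis by simp
qed

section \<open>Small-ball probabilities of Gaussian increments\<close>

lemma nn_integral_normal_density_ball:
  assumes "0 < \<sigma>" "0 < \<rho>"
  shows "(\<integral>\<^sup>+y. ennreal (normal_density 0 \<sigma> y) * indicator {y. \<bar>y - c\<bar> < \<rho>} y \<partial>lborel)
    \<le> ennreal (min 1 (\<rho> / \<sigma>))"
proof -
  let ?I = "\<integral>\<^sup>+y. ennreal (normal_density 0 \<sigma> y) * indicator {y. \<bar>y - c\<bar> < \<rho>} y \<partial>lborel"
  interpret N: prob_space "density lborel (normal_density 0 \<sigma>)"
    using assms(1) by (rule prob_space_normal_density)
  have "?I = emeasure (density lborel (normal_density 0 \<sigma>)) {y. \<bar>y - c\<bar> < \<rho>}"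
    by (subst emeasure_density) auto
  also have "\<dots> \<le> 1" by (rule N.emeasure_le_1)
  finally have 1: "?I \<le> 1" .
  \<comment> \<open>Since sqrt (2 pi) \<ge> 2, the density is at most 1 / (2 \<sigma>) everywhere.
    Multiplied by the length 2 \<rho> of the interval this gives \<rho> / \<sigma>, whatever the
    centre \<open>c\<close>.\<close>
  have bd: "normal_density 0 \<sigma> y \<le> 1 / (2 * \<sigma>)" for y
  proof -
    have "4 \<le> 2 * pi" using pi_gt3 by simp
    then have "(2 * \<sigma>)\<^sup>2 \<le> 2 * pi * \<sigma>\<^sup>2"
      by (simp add: power_mult_distrib mult_right_mono)
    then have "2 * \<sigma> \<le> sqrt (2 * pi * \<sigma>\<^sup>2)" by (rule real_le_rsqrt)
    then have "1 / sqrt (2 * pi * \<sigma>\<^sup>2) * exp (- (y - 0)\<^sup>2 / (2 * \<sigma>\<^sup>2)) \<le> 1 / (2 * \<sigma>) * 1"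
      using assms by (intro mult_mono frac_le) auto
    then show ?thesis unfolding normal_density_def by simp
  qed
  have "?I \<le> (\<integral>\<^sup>+y. ennreal (1 / (2 * \<sigma>)) * indicator {y. \<bar>y - c\<bar> < \<rho>} y \<partial>lborel)"
    using bd by (intro nn_integral_mono mult_right_mono ennreal_leI) auto
  also have "\<dots> = ennreal (1 / (2 * \<sigma>)) * emeasure lborel {y. \<bar>y - c\<bar> < \<rho>}"
    by (subst nn_integral_cmult_indicator) auto
  also have "emeasure lborel {y. \<bar>y - c\<bar> < \<rho>} = ennreal (2 * \<rho>)"
  proof -
    have "{y. \<bar>y - c\<bar> < \<rho>} = {c - \<rho><..<c + \<rho>}" by auto
    then show ?thesis using assms by simp
  qed
  also have "ennreal (1 / (2 * \<sigma>)) * ennreal (2 * \<rho>) = ennreal (\<rho> / \<sigma>)"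
    using assms by (simp flip: ennreal_mult')
  finally show ?thesis using 1 by (simp add: min_def)
qed


text \<open>Bridge to \<open>nn_integral_lborel_prod\<close>, which factorises over
  \<open>Basis\<close>, whereas the density in the locale runs over coordinates.\<close>

lemma prod_components_eq_prod_Basis:
  fixes x :: "real ^ 'd"
  shows "(\<Prod>i\<in>UNIV. g (x $ i)) = (\<Prod>b\<in>Basis. g (x \<bullet> b))"
proof -
  have Basis: "(Basis :: (real ^ 'd) set) = (\<lambda>i. axis i 1) ` UNIV"
    by (auto simp: Basis_vec_def)
  have "inj (\<lambda>i. axis i (1::real) :: real ^ 'd)"
    by (auto simp: inj_def axis_eq_axis)
  then show ?thesis unfolding Basis by (simp add: prod.reindex inner_axis)
qed

context standard_brownian_motion
begin

text \<open>The ball lies in a cube of half-side \<open>\<rho>\<close>, over which the density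
  factorises into d one-dimensional integrals, each at most \<open>m\<close>. Truncating
  \<open>m\<close> at 1 is what allows the exponent d to be lowered to 2 q.\<close>

lemma prob_increment_near_le:
  assumes st: "0 \<le> s" "s < t" and "0 < \<rho>" and q: "0 \<le> q" "2 * q \<le> real CARD('d)"
  shows "prob {\<omega> \<in> space M. norm (B t \<omega> - B s \<omega> - c) < \<rho>} \<le> (\<rho>\<^sup>2 / (t - s)) powr q"
proof -
  define \<sigma> where "\<sigma> = sqrt (t - s)"
  have "0 < \<sigma>" unfolding \<sigma>_def using st by simp
  define m where "m = min 1 (\<rho> / \<sigma>)"
  have m: "0 < m" "m \<le> 1" "m \<le> \<rho> / \<sigma>" unfolding m_def using \<open>0 < \<rho>\<close> \<open>0 < \<sigma>\<close> by auto
  let ?f = "\<lambda>b y. ennreal (normal_density 0 \<sigma> y) * indicator {y. \<bar>y - c \<bullet> b\<bar> < \<rho>} y"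
  have *: "{\<omega> \<in> space M. norm (B t \<omega> - B s \<omega> - c) < \<rho>}
      = (\<lambda>\<omega>. B t \<omega> - B s \<omega>) -` ball c \<rho> \<inter> space M"
    by (auto simp: dist_norm norm_minus_commute)
  have "emeasure M {\<omega> \<in> space M. norm (B t \<omega> - B s \<omega> - c) < \<rho>}
      = (\<integral>\<^sup>+x. ennreal (\<Prod>i\<in>UNIV. normal_density 0 \<sigma> (x $ i)) * indicator (ball c \<rho>) x \<partial>lborel)"
    unfolding * \<sigma>_def by (rule distributed_emeasure[OF gaussian_increments[OF st]]) simp
  also have "\<dots> \<le> (\<integral>\<^sup>+x. (\<Prod>b\<in>Basis. ?f b (x \<bullet> b)) \<partial>lborel)"
  proof (rule nn_integral_mono)
    fix x :: "real ^ 'd"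
    have "ennreal (\<Prod>i\<in>UNIV. normal_density 0 \<sigma> (x $ i)) = (\<Prod>b\<in>Basis. ennreal (normal_density 0 \<sigma> (x \<bullet> b)))"
      by (simp add: prod_components_eq_prod_Basis prod_ennreal)
    moreover have "indicator {y. \<bar>y - c \<bullet> b\<bar> < \<rho>} (x \<bullet> b) = (1::ennreal)"
      if "b \<in> Basis" "x \<in> ball c \<rho>" for b
    proof -
      have "\<bar>(x - c) \<bullet> b\<bar> \<le> norm (x - c)" using that by (intro Basis_le_norm)
      then show ?thesis using that by (auto simp: dist_norm norm_minus_commute inner_diff_left)
    qed
    ultimately show "ennreal (\<Prod>i\<in>UNIV. normal_density 0 \<sigma> (x $ i)) * indicator (ball c \<rho>) x
        \<le> (\<Prod>b\<in>Basis. ?f b (x \<bullet> b))"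
      by (cases "x \<in> ball c \<rho>") auto
  qed
  also have "\<dots> = (\<Prod>b\<in>Basis. \<integral>\<^sup>+y. ?f b y \<partial>lborel)"
    by (intro nn_integral_lborel_prod) auto
  also have "\<dots> \<le> (\<Prod>b\<in>(Basis :: (real ^ 'd) set). ennreal m)"
    unfolding m_def
    using nn_integral_normal_density_ball[OF \<open>0 < \<sigma>\<close> \<open>0 < \<rho>\<close>] by (intro prod_mono_ennreal) auto
  also have "\<dots> = ennreal (m ^ CARD('d))" using m by (simp add: ennreal_power)
  finally have "prob {\<omega> \<in> space M. norm (B t \<omega> - B s \<omega> - c) < \<rho>} \<le> m ^ CARD('d)"
    using m by (simp add: emeasure_eq_measure)
  also have "\<dots> = m powr real CARD('d)" using m by (simp add: powr_realpow)
  also have "\<dots> \<le> m powr (2 * q)" using m q by (intro powr_mono') auto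
  also have "\<dots> \<le> (\<rho> / \<sigma>) powr (2 * q)" using m q by (intro powr_mono2) auto
  also have "\<dots> = (\<rho>\<^sup>2 / (t - s)) powr q"
  proof -
    have "(\<rho> / \<sigma>) powr 2 = \<rho>\<^sup>2 / (t - s)"
      using \<open>0 < \<rho>\<close> \<open>0 < \<sigma>\<close> st unfolding \<sigma>_def by (simp add: power_divide)
    then show ?thesis by (simp flip: powr_powr)
  qed
  finally show ?thesis .
qed

text \<open>The values of f enter as the translation c = f s - f t, over which the preceding bound
  is uniform.\<close>

lemma prob_image_near_le:
  assumes "s \<in> {0..}" "t \<in> {0..}" "s \<noteq> t" "0 < \<rho>" "0 \<le> q" "2 * q \<le> real CARD('d)"
  shows "prob {\<omega> \<in> space M. dist (B s \<omega> + f s) (B t \<omega> + f t) < \<rho>} \<le> (\<rho>\<^sup>2) powr q * \<bar>t - s\<bar> powr - q"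
proof -
  have *: "prob {\<omega> \<in> space M. dist (B s \<omega> + f s) (B t \<omega> + f t) < \<rho>} \<le> (\<rho>\<^sup>2 / (t - s)) powr q"
    if "0 \<le> s" "s < t" for s t
  proof -
    have "{\<omega> \<in> space M. dist (B s \<omega> + f s) (B t \<omega> + f t) < \<rho>}
        = {\<omega> \<in> space M. norm (B t \<omega> - B s \<omega> - (f s - f t)) < \<rho>}"
      by (simp add: dist_norm norm_minus_commute algebra_simps)
    then show ?thesis using prob_increment_near_le[OF that assms(4-6)] by simp
  qed
  have "prob {\<omega> \<in> space M. dist (B s \<omega> + f s) (B t \<omega> + f t) < \<rho>} \<le> (\<rho>\<^sup>2 / \<bar>t - s\<bar>) powr q"
  proof (cases "s < t")
    case True
    then show ?thesis using *[of s t] assms by simp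
  next
    case False
    then show ?thesis using *[of t s] assms by (simp add: dist_commute)
  qed
  also have "\<dots> = (\<rho>\<^sup>2) powr q * \<bar>t - s\<bar> powr - q"
    by (simp add: powr_divide powr_minus_divide)
  finally show ?thesis .
qed

text \<open>
  Delete from T every point with a close partner: the images of the remaining points form a
  packing, and fewer than half of the points are deleted unless there are many close pairs.
\<close>

lemma image_packing_of_separated:
  assumes T: "finite T" "T \<noteq> {}" "T \<subseteq> {0..}" and "0 < r" "0 < \<rho>" "0 < q" "q < 1" "2 * q \<le> real CARD('d)"
    and sep: "\<And>s t. s \<in> T \<Longrightarrow> t \<in> T \<Longrightarrow> s \<noteq> t \<Longrightarrow> 2 * r \<le> dist s t"
  obtains F where "F \<in> sets M"
    "prob F \<le> 8 / (1 - q) * (\<rho>\<^sup>2) powr q * r powr - q * real (card T) powr (1 - q)"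
    "\<And>\<omega> A. \<omega> \<in> space M - F \<Longrightarrow> bounded ((\<lambda>t. B t \<omega> + f t) ` A) \<Longrightarrow> T \<subseteq> A \<Longrightarrow>
       real (card T) / 2 \<le> real (packing_number ((\<lambda>t. B t \<omega> + f t) ` A) \<rho>)"
proof -
  \<comment> \<open>Radius 2 * \<rho>, because balls of radius \<open>\<rho>\<close> are disjoint
    exactly when their centres are at least that far apart.\<close>
  define D where "D s t = {\<omega> \<in> space M. dist (B s \<omega> + f s) (B t \<omega> + f t) < 2 * \<rho>}" for s t
  have D[measurable]: "D s t \<in> sets M" if "s \<in> T" "t \<in> T" for s t
  proof -
    have [measurable]: "B s \<in> borel_measurable M" "B t \<in> borel_measurable M"
      using that T(3) by (auto intro: measurable_B)
    show ?thesis unfolding D_def by measurable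
  qed
  \<comment> \<open>\<open>Q\<close> counts ordered close pairs, so a point with a close partner
    contributes at least 1 through its own inner sum.\<close>
  define Q where "Q \<omega> = (\<Sum>s\<in>T. \<Sum>t\<in>T - {s}. indicator (D s t) \<omega> :: real)" for \<omega>
  define n where "n = real (card T)"
  have "0 < n" unfolding n_def using T by (simp add: card_gt_0_iff)
  define F where "F = {\<omega> \<in> space M. n / 2 \<le> Q \<omega>}"
  have int_D: "integrable M (indicator (D s t) :: _ \<Rightarrow> real)" if "s \<in> T" "t \<in> T" for s t
    using that D by (intro integrable_real_indicator) (auto simp: less_top[symmetric])
  have exp_D: "expectation (indicator (D s t)) = prob (D s t)" if "s \<in> T" "t \<in> T" for s t
    using D[OF that] sets.sets_into_space[OF D[OF that]] by (simp add: Int_absorb2)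
  have int_Q: "integrable M Q"
    unfolding Q_def using int_D by (intro Bochner_Integration.integrable_sum) auto
  have "expectation Q = (\<Sum>s\<in>T. expectation (\<lambda>\<omega>. \<Sum>t\<in>T - {s}. indicator (D s t) \<omega>))"
    unfolding Q_def using int_D
    by (intro Bochner_Integration.integral_sum Bochner_Integration.integrable_sum) auto
  also have "\<dots> = (\<Sum>s\<in>T. \<Sum>t\<in>T - {s}. expectation (indicator (D s t)))"
    using int_D by (intro sum.cong refl Bochner_Integration.integral_sum) auto
  also have "\<dots> = (\<Sum>s\<in>T. \<Sum>t\<in>T - {s}. prob (D s t))"
    by (intro sum.cong refl exp_D) auto
  also have "\<dots> \<le> (\<Sum>s\<in>T. \<Sum>t\<in>T - {s}. ((2 * \<rho>)\<^sup>2) powr q * \<bar>t - s\<bar> powr - q)"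
    unfolding D_def using assms by (intro sum_mono prob_image_near_le) auto
  also have "\<dots> = (\<Sum>s\<in>T. ((2 * \<rho>)\<^sup>2) powr q * (\<Sum>t\<in>T - {s}. \<bar>t - s\<bar> powr - q))"
    by (simp add: sum_distrib_left)
  also have "\<dots> \<le> (\<Sum>s\<in>T. ((2 * \<rho>)\<^sup>2) powr q * (2 * (2 * r) powr - q * (n powr (1 - q) / (1 - q))))"
    unfolding n_def using assms by (intro sum_mono mult_left_mono sum_powr_minus_separated) auto
  also have "\<dots> = n * (((2 * \<rho>)\<^sup>2) powr q * (2 * (2 * r) powr - q * (n powr (1 - q) / (1 - q))))"
    by (simp add: n_def)
  \<comment> \<open>The two factors 2 powr q from (2 \<rho>) squared meet one factor 2 powr - q from
    the separation 2 r, so a single 2 powr q survives.\<close>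
  also have "\<dots> = n * (2 powr q * 2 / (1 - q)) * (\<rho>\<^sup>2) powr q * r powr - q * n powr (1 - q)"
  proof -
    have "((2 * \<rho>)\<^sup>2) powr q = (2 powr q * 2 powr q) * (\<rho>\<^sup>2) powr q"
    proof -
      have "(2 * \<rho>)\<^sup>2 = 2 * (2 * \<rho>\<^sup>2)" by (simp add: power2_eq_square)
      then show ?thesis by (simp only: powr_mult mult.assoc)
    qed
    moreover have "(2 * r) powr - q = r powr - q / 2 powr q"
      using \<open>0 < r\<close> by (simp add: powr_mult powr_minus_divide)
    ultimately show ?thesis by simp
  qed
  finally have EQ: "expectation Q \<le> n * (2 powr q * 2 / (1 - q)) * (\<rho>\<^sup>2) powr q * r powr - q * n powr (1 - q)" .
  have [measurable]: "Q \<in> borel_measurable M" using int_Q by simp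
  have F: "F \<in> sets M" unfolding F_def by measurable
  have "prob F \<le> expectation Q / (n / 2)"
    unfolding F_def
  proof (rule integral_Markov_inequality_measure[OF int_Q, where A = "{}"])
    show "AE \<omega> in M. 0 \<le> Q \<omega>" unfolding Q_def by (simp add: sum_nonneg)
  qed (use \<open>0 < n\<close> in auto)
  also have "\<dots> \<le> (n * (2 powr q * 2 / (1 - q)) * (\<rho>\<^sup>2) powr q * r powr - q * n powr (1 - q)) / (n / 2)"
    using EQ \<open>0 < n\<close> by (intro divide_right_mono) auto
  also have "\<dots> = (2 powr q * 4 / (1 - q)) * ((\<rho>\<^sup>2) powr q * r powr - q * n powr (1 - q))"
    using \<open>0 < n\<close> by simp
  also have "\<dots> \<le> 8 / (1 - q) * ((\<rho>\<^sup>2) powr q * r powr - q * n powr (1 - q))"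
    using powr_mono[of q 1 2] assms by (intro mult_right_mono divide_right_mono) auto
  finally have PF: "prob F \<le> 8 / (1 - q) * (\<rho>\<^sup>2) powr q * r powr - q * n powr (1 - q)"
    by (simp add: mult.assoc)
  have "n / 2 \<le> real (packing_number ((\<lambda>t. B t \<omega> + f t) ` A) \<rho>)"
    if \<omega>: "\<omega> \<in> space M - F" and bd: "bounded ((\<lambda>t. B t \<omega> + f t) ` A)" and "T \<subseteq> A" for \<omega> A
  proof -
    let ?X = "\<lambda>t. B t \<omega> + f t"
    define T' where "T' = {s \<in> T. \<forall>t\<in>T - {s}. \<omega> \<notin> D s t}"
    have far: "2 * \<rho> \<le> dist (?X s) (?X t)" if "s \<in> T'" "t \<in> T" "s \<noteq> t" for s t
    proof -
      have "\<omega> \<notin> D s t" using that unfolding T'_def by blast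
      then show ?thesis using \<omega> unfolding D_def by auto
    qed
    have "real (card (T - T')) = (\<Sum>s\<in>T - T'. 1)" by simp
    also have "\<dots> \<le> (\<Sum>s\<in>T - T'. \<Sum>t\<in>T - {s}. indicator (D s t) \<omega>)"
    proof (rule sum_mono)
      fix s assume "s \<in> T - T'"
      then obtain t where t: "t \<in> T - {s}" "\<omega> \<in> D s t" unfolding T'_def by blast
      have "(1::real) = indicator (D s t) \<omega>" using t by simp
      also have "\<dots> \<le> (\<Sum>t\<in>T - {s}. indicator (D s t) \<omega>)"
        using t T(1) by (intro member_le_sum) auto
      finally show "1 \<le> (\<Sum>t\<in>T - {s}. indicator (D s t) \<omega> :: real)" .
    qed
    also have "\<dots> \<le> Q \<omega>"
      unfolding Q_def using T(1) by (intro sum_mono2) (auto intro: sum_nonneg)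
    also have "\<dots> < n / 2" using \<omega> unfolding F_def by auto
    finally have "real (card (T - T')) < n / 2" .
    moreover have "T' \<subseteq> T" unfolding T'_def by auto
    then have "card (T - T') = card T - card T'" "card T' \<le> card T"
      using T(1) by (auto intro: card_Diff_subset card_mono finite_subset)
    ultimately have "n / 2 \<le> card T'" unfolding n_def by linarith
    have inj: "inj_on ?X T'"
    proof (rule inj_onI, rule ccontr)
      fix s t assume "s \<in> T'" "t \<in> T'" "?X s = ?X t" "s \<noteq> t"
      then show False using far[of s t] \<open>T' \<subseteq> T\<close> \<open>0 < \<rho>\<close> by auto
    qed
    have "card (?X ` T') \<le> packing_number (?X ` A) \<rho>"
    proof (rule packing_number_ge[OF bd \<open>0 < \<rho>\<close>])
      show "?X ` T' \<subseteq> ?X ` A" using \<open>T' \<subseteq> T\<close> \<open>T \<subseteq> A\<close> by blast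
      show "finite (?X ` T')" using finite_subset[OF \<open>T' \<subseteq> T\<close> T(1)] by simp
      show "2 * \<rho> \<le> dist x y" if "x \<in> ?X ` T'" "y \<in> ?X ` T'" "x \<noteq> y" for x y
        using that far \<open>T' \<subseteq> T\<close> by blast
    qed
    then show ?thesis using \<open>n / 2 \<le> card T'\<close> card_image[OF inj] by linarith
  qed
  with F PF show thesis unfolding n_def by (intro that) auto
qed

end

section \<open>Lower bounds for the dimensions of the image\<close>

text \<open>One-sided limits bound f on a punctured neighbourhood of each t, the value f t adds one
  point, and compactness of the unit interval leaves finitely many neighbourhoods. At an endpoint
  the outer side misses the interval, so any outer bound will do.\<close>

lemma cadlag_imp_bounded_image:
  fixes f :: "real \<Rightarrow> 'a::metric_space"
  assumes "cadlag f"
  shows "bounded (f ` {0..1})"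
proof -
  have "\<exists>U. open U \<and> t \<in> U \<and> bounded (f ` (U \<inter> {0..1}))" if t: "t \<in> {0..1}" for t
  proof -
    have "\<exists>b>t. bounded (f ` ({t<..<b} \<inter> {0..1}))"
    proof (cases "t = 1")
      case False
      then have "(f \<longlongrightarrow> f t) (at_right t)" using assms t unfolding cadlag_def by auto
      then have "\<forall>\<^sub>F y in at_right t. dist (f y) (f t) < 1" by (rule tendstoD) simp
      then obtain b where b: "b > t" "\<And>y. t < y \<Longrightarrow> y < b \<Longrightarrow> dist (f y) (f t) < 1"
        unfolding eventually_at_right_field by blast
      then have "f ` ({t<..<b} \<inter> {0..1}) \<subseteq> ball (f t) 1" by (auto simp: dist_commute)
      then show ?thesis using b(1) bounded_subset[OF bounded_ball] by blast
    next
      case True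
      then have "f ` ({t<..<2} \<inter> {0..1}) = {}" by auto
      then show ?thesis using True by (metis bounded_empty one_less_numeral_iff semiring_norm(76))
    qed
    then obtain b where b: "t < b" "bounded (f ` ({t<..<b} \<inter> {0..1}))" by blast
    have "\<exists>a<t. bounded (f ` ({a<..<t} \<inter> {0..1}))"
    proof (cases "t = 0")
      case False
      then have "t \<in> {0<..1}" using t by auto
      then obtain l where "(f \<longlongrightarrow> l) (at_left t)" using assms unfolding cadlag_def by blast
      then have "\<forall>\<^sub>F y in at_left t. dist (f y) l < 1" by (rule tendstoD) simp
      then obtain a where a: "a < t" "\<And>y. a < y \<Longrightarrow> y < t \<Longrightarrow> dist (f y) l < 1"
        unfolding eventually_at_left_field by blast
      then have "f ` ({a<..<t} \<inter> {0..1}) \<subseteq> ball l 1" by (auto simp: dist_commute)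
      then show ?thesis using a(1) bounded_subset[OF bounded_ball] by blast
    next
      case True
      then have "f ` ({-1<..<t} \<inter> {0..1}) = {}" by auto
      then show ?thesis using True by (metis bounded_empty neg_less_0_iff_less zero_less_one)
    qed
    then obtain a where a: "a < t" "bounded (f ` ({a<..<t} \<inter> {0..1}))" by blast
    have "f ` ({a<..<b} \<inter> {0..1}) \<subseteq> f ` ({a<..<t} \<inter> {0..1}) \<union> f ` ({t<..<b} \<inter> {0..1}) \<union> {f t}"
    proof -
      have "{a<..<b} \<inter> {0..1} \<subseteq> ({a<..<t} \<inter> {0..1}) \<union> ({t<..<b} \<inter> {0..1}) \<union> {t}" by auto
      then show ?thesis by blast
    qed
    moreover have "bounded (f ` ({a<..<t} \<inter> {0..1}) \<union> f ` ({t<..<b} \<inter> {0..1}) \<union> {f t})"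
      using a b by simp
    ultimately have "bounded (f ` ({a<..<b} \<inter> {0..1}))" by (rule bounded_subset[rotated])
    then show ?thesis using a b by (intro exI[of _ "{a<..<b}"]) auto
  qed
  then obtain U where U: "\<And>t. t \<in> {0..1} \<Longrightarrow> open (U t) \<and> t \<in> U t \<and> bounded (f ` (U t \<inter> {0..1}))"
    by metis
  obtain C where C: "C \<subseteq> {0..1}" "finite C" "{0..1} \<subseteq> (\<Union>t\<in>C. U t)"
    by (rule compactE_image[OF compact_Icc[of 0 "1::real"], of "{0..1}" U]) (use U in auto)
  have "f ` {0..1} \<subseteq> (\<Union>t\<in>C. f ` (U t \<inter> {0..1}))" using C(3) by blast
  moreover have "bounded (\<Union>t\<in>C. f ` (U t \<inter> {0..1}))" using C U by (intro bounded_UN) auto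
  ultimately show ?thesis by (rule bounded_subset[rotated])
qed

section \<open>Almost sure packings of the image at all small dyadic scales\<close>

context standard_brownian_motion
begin

text \<open>Needed before any packing number of the image can be estimated. Continuous paths are
  bounded on the compact unit interval.\<close>

lemma AE_bounded_image:
  assumes "cadlag f" "A \<subseteq> {0..1}"
  shows "AE \<omega> in M. bounded ((\<lambda>t. B t \<omega> + f t) ` A)"
  using continuous_paths
proof eventually_elim
  case (elim \<omega>)
  have "compact ((\<lambda>t. B t \<omega>) ` {0..1})"
    using continuous_on_subset[OF elim, of "{0..1}"] by (intro compact_continuous_image) auto
  then have "bounded ((\<lambda>t. B t \<omega>) ` A)"
    by (rule bounded_subset[OF compact_imp_bounded image_mono[OF assms(2)]])
  moreover have "bounded (f ` A)"
    by (rule bounded_subset[OF cadlag_imp_bounded_image[OF assms(1)] image_mono[OF assms(2)]])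
  ultimately show ?case by (rule bounded_plus_comp)
qed

text \<open>Whether \<open>A\<close> has enough points at scale m does not depend on \<omega>. If it
  has too few, the empty event works, since the last claim is then vacuous; so an event is available
  for every m, as Borel-Cantelli requires.\<close>

lemma image_packing_dyadic_event:
  assumes A: "A \<subseteq> {0..1}" and "0 \<le> a" "0 < q" "q < 1" "2 * q \<le> real CARD('d)"
  obtains F where "F \<in> sets M"
    "prob F \<le> 16 / (1 - q) * 2 powr (- (2 * q * \<kappa> - q - a * (1 - q)) * real m)"
    "\<And>\<omega>. \<omega> \<in> space M - F \<Longrightarrow> bounded ((\<lambda>t. B t \<omega> + f t) ` A) \<Longrightarrow>
       2 powr (a * real m) \<le> real (packing_number A (2 powr - real m)) \<Longrightarrow>
       1 / 2 * 2 powr (a * real m) \<le> real (packing_number ((\<lambda>t. B t \<omega> + f t) ` A) (2 powr - (\<kappa> * real m)))"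
proof (cases "2 powr (a * real m) \<le> real (packing_number A (2 powr - real m))")
  case False
  show thesis by (rule that[of "{}"]) (use False assms in auto)
next
  case True
  have "bounded A" using A bounded_subset[OF bounded_closed_interval] by blast
  then obtain S where S: "S \<subseteq> A" "finite S" "card S = packing_number A (2 powr - real m)"
    "\<And>x y. x \<in> S \<Longrightarrow> y \<in> S \<Longrightarrow> x \<noteq> y \<Longrightarrow> 2 * 2 powr - real m \<le> dist x y"
    using packing_number_attained[of A "2 powr - real m"] by auto
  \<comment> \<open>The bound for \<open>prob F\<close> grows with the number of points, and
    \<open>S\<close> may be far larger than 2 powr (a * m); hence only about that many points are
    kept. As 2 powr (a * m) is at least 1, rounding up at most doubles it.\<close>
  define n where "n = nat \<lceil>2 powr (a * real m)\<rceil>"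
  have n: "2 powr (a * real m) \<le> n" "n < 2 powr (a * real m) + 1"
    unfolding n_def using powr_gt_zero[of 2 "a * real m"] by linarith+
  have "n \<le> card S" unfolding n_def using True S(3) by linarith
  then obtain T where T: "T \<subseteq> S" "card T = n" "finite T" by (rule obtain_subset_with_card_n)
  have ge1: "1 \<le> 2 powr (a * real m)" using assms by (intro ge_one_powr_ge_zero) auto
  then have "T \<noteq> {}" using T n by auto
  have Tpos: "T \<subseteq> {0..}" using T(1) S(1) A by fastforce
  have Tsep: "2 * 2 powr - real m \<le> dist s t" if "s \<in> T" "t \<in> T" "s \<noteq> t" for s t
    using T(1) S(4) that by blast
  obtain F where F: "F \<in> sets M"
    "prob F \<le> 8 / (1 - q) * ((2 powr - (\<kappa> * real m))\<^sup>2) powr q * (2 powr - real m) powr - q * real (card T) powr (1 - q)"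
    "\<And>\<omega> A. \<omega> \<in> space M - F \<Longrightarrow> bounded ((\<lambda>t. B t \<omega> + f t) ` A) \<Longrightarrow> T \<subseteq> A \<Longrightarrow>
       real (card T) / 2 \<le> real (packing_number ((\<lambda>t. B t \<omega> + f t) ` A) (2 powr - (\<kappa> * real m)))"
    by (rule image_packing_of_separated[of T "2 powr - real m" "2 powr - (\<kappa> * real m)" q f])
       (use T(3) Tpos Tsep \<open>T \<noteq> {}\<close> assms in simp_all)
  have "real (card T) powr (1 - q) \<le> (2 * 2 powr (a * real m)) powr (1 - q)"
    using T n ge1 assms by (intro powr_mono2) auto
  also have "\<dots> = 2 powr (1 - q) * 2 powr (a * real m * (1 - q))"
    by (simp add: powr_mult powr_powr)
  also have "\<dots> \<le> 2 * 2 powr (a * real m * (1 - q))"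
    using powr_mono[of "1 - q" 1 2] assms by (intro mult_right_mono) auto
  finally have *: "real (card T) powr (1 - q) \<le> 2 * 2 powr (a * real m * (1 - q))" .
  have "prob F \<le> 8 / (1 - q) * ((2 powr - (\<kappa> * real m))\<^sup>2) powr q * (2 powr - real m) powr - q
      * (2 * 2 powr (a * real m * (1 - q)))"
    using assms by (intro order_trans[OF F(2)] mult_left_mono *) auto
  also have "(2 powr - (\<kappa> * real m))\<^sup>2 = 2 powr (- (\<kappa> * real m) * 2)"
    by (simp add: powr_power mult.commute)
  also have "8 / (1 - q) * (2 powr (- (\<kappa> * real m) * 2)) powr q * (2 powr - real m) powr - q
      * (2 * 2 powr (a * real m * (1 - q)))
      = 16 / (1 - q) * (2 powr (- (\<kappa> * real m) * 2 * q) * 2 powr (- real m * - q) * 2 powr (a * real m * (1 - q)))"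
    by (simp only: powr_powr)
  also have "\<dots> = 16 / (1 - q) * 2 powr (- (2 * q * \<kappa> - q - a * (1 - q)) * real m)"
    by (simp only: powr_add[symmetric]) (simp add: algebra_simps)
  finally have PF: "prob F \<le> 16 / (1 - q) * 2 powr (- (2 * q * \<kappa> - q - a * (1 - q)) * real m)" .
  show thesis
  proof (rule that[OF F(1) PF])
    fix \<omega> assume \<omega>: "\<omega> \<in> space M - F" "bounded ((\<lambda>t. B t \<omega> + f t) ` A)"
    have "T \<subseteq> A" using T(1) S(1) by blast
    from F(3)[OF \<omega> this] n(1)
    show "1 / 2 * 2 powr (a * real m) \<le> real (packing_number ((\<lambda>t. B t \<omega> + f t) ` A) (2 powr - (\<kappa> * real m)))"
      unfolding T(2) by linarith
  qed
qed

text \<open>The last condition on \<open>q\<close> makes the exponent \<open>\<delta>\<close>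
  positive, so that the probabilities of the exceptional events decay geometrically and are
  summable.\<close>

lemma AE_minkowski_dim_image_ge:
  assumes f: "cadlag f" and A: "A \<subseteq> {0..1}" "A \<noteq> {}" and "0 \<le> a" "0 < \<kappa>"
    and q: "0 < q" "q < 1" "2 * q \<le> real CARD('d)" "q + a * (1 - q) < 2 * q * \<kappa>"
  shows "AE \<omega> in M.
    (ereal a < lower_minkowski_dim A \<longrightarrow> ereal (a / \<kappa>) \<le> lower_minkowski_dim ((\<lambda>t. B t \<omega> + f t) ` A)) \<and>
    (ereal a < upper_minkowski_dim A \<longrightarrow> ereal (a / \<kappa>) \<le> upper_minkowski_dim ((\<lambda>t. B t \<omega> + f t) ` A))"
proof -
  define \<delta> where "\<delta> = 2 * q * \<kappa> - q - a * (1 - q)"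
  have "0 < \<delta>" unfolding \<delta>_def using q by simp
  have "\<forall>m. \<exists>F. F \<in> sets M \<and> prob F \<le> 16 / (1 - q) * 2 powr (- \<delta> * real m) \<and>
      (\<forall>\<omega> \<in> space M - F. bounded ((\<lambda>t. B t \<omega> + f t) ` A) \<longrightarrow>
       2 powr (a * real m) \<le> real (packing_number A (2 powr - real m)) \<longrightarrow>
       1 / 2 * 2 powr (a * real m) \<le> real (packing_number ((\<lambda>t. B t \<omega> + f t) ` A) (2 powr - (\<kappa> * real m))))"
    unfolding \<delta>_def
  proof
    fix m
    show "\<exists>F. F \<in> sets M \<and> prob F \<le> 16 / (1 - q) * 2 powr (- (2 * q * \<kappa> - q - a * (1 - q)) * real m) \<and>
      (\<forall>\<omega> \<in> space M - F. bounded ((\<lambda>t. B t \<omega> + f t) ` A) \<longrightarrow>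
       2 powr (a * real m) \<le> real (packing_number A (2 powr - real m)) \<longrightarrow>
       1 / 2 * 2 powr (a * real m) \<le> real (packing_number ((\<lambda>t. B t \<omega> + f t) ` A) (2 powr - (\<kappa> * real m))))"
      by (rule image_packing_dyadic_event[OF A(1) \<open>0 \<le> a\<close> q(1-3), of \<kappa> m f]) blast
  qed
  from choice[OF this] obtain F where F: "\<And>m. F m \<in> sets M" "\<And>m. prob (F m) \<le> 16 / (1 - q) * 2 powr (- \<delta> * real m)"
    "\<And>m \<omega>. \<omega> \<in> space M - F m \<Longrightarrow> bounded ((\<lambda>t. B t \<omega> + f t) ` A) \<Longrightarrow>
       2 powr (a * real m) \<le> real (packing_number A (2 powr - real m)) \<Longrightarrow>
       1 / 2 * 2 powr (a * real m) \<le> real (packing_number ((\<lambda>t. B t \<omega> + f t) ` A) (2 powr - (\<kappa> * real m)))"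
    by blast
  have summable: "summable (\<lambda>m. 16 / (1 - q) * (2 powr - \<delta>) ^ m)"
    using \<open>0 < \<delta>\<close> powr_less_mono[of "- \<delta>" 0 2] by (intro summable_mult summable_geometric) auto
  have geometric: "2 powr (- \<delta> * real m) = (2 powr - \<delta>) ^ m" for m
    by (simp add: powr_power mult.commute)
  have "summable (\<lambda>m. prob (F m))"
  proof (rule summable_comparison_test'[OF summable])
    show "norm (prob (F m)) \<le> 16 / (1 - q) * (2 powr - \<delta>) ^ m" for m
      using F(2)[of m] unfolding geometric by simp
  qed
  then have "AE \<omega> in M. \<forall>\<^sub>F m in sequentially. \<omega> \<in> space M - F m"
    using F(1) by (intro borel_cantelli_AE1) (auto simp: less_top[symmetric])
  with AE_bounded_image[OF f A(1)] show ?thesis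
  proof eventually_elim
    case (elim \<omega>)
    let ?E = "(\<lambda>t. B t \<omega> + f t) ` A"
    have "bounded A" using A bounded_subset[OF bounded_closed_interval] by blast
    \<comment> \<open>An implication valid at all large m combines equally well with an eventual
      premise, giving the lower dimension, and with a frequent one, giving the upper
      dimension.\<close>
    have ev: "\<forall>\<^sub>F m in sequentially. 2 powr (a * real m) \<le> real (packing_number A (2 powr - real m)) \<longrightarrow>
       1 / 2 * 2 powr (a * real m) \<le> real (packing_number ?E (2 powr - (\<kappa> * real m)))"
      using elim(2) by eventually_elim (use F(3) elim(1) in blast)
    show ?case
    proof (intro conjI impI)
      assume "ereal a < lower_minkowski_dim A"
      from eventually_packing_number_dyadic[OF \<open>bounded A\<close> A(2) this] ev
      have "\<forall>\<^sub>F m in sequentially. 1 / 2 * 2 powr (a * real m) \<le> real (packing_number ?E (2 powr - (\<kappa> * real m)))"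
        by eventually_elim blast
      then show "ereal (a / \<kappa>) \<le> lower_minkowski_dim ?E"
        using elim(1) A(2) assms by (intro lower_minkowski_dim_geI[of _ "1/2"]) auto
    next
      assume "ereal a < upper_minkowski_dim A"
      from frequently_packing_number_dyadic[OF \<open>bounded A\<close> A(2) this \<open>0 \<le> a\<close>] ev
      have "\<exists>\<^sub>F m in sequentially. 1 / 2 * 2 powr (a * real m) \<le> real (packing_number ?E (2 powr - (\<kappa> * real m)))"
        by (rule frequently_rev_mp)
      then show "ereal (a / \<kappa>) \<le> upper_minkowski_dim ?E"
        using assms by (intro upper_minkowski_dim_geI[of "1/2"]) auto
    qed
  qed
qed

end

text \<open>The null set depends on \<open>c\<close>, so only rational \<open>c\<close> are used.
  Nonnegativity of \<open>Y\<close> makes the positive ones suffice, for which quotients such as a /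
  c are available.\<close>

lemma AE_ereal_leI:
  fixes Y :: "'w \<Rightarrow> ereal"
  assumes "AE \<omega> in M. 0 \<le> Y \<omega>"
    and "\<And>c::real. 0 < c \<Longrightarrow> ereal c < x \<Longrightarrow> AE \<omega> in M. ereal c \<le> Y \<omega>"
  shows "AE \<omega> in M. x \<le> Y \<omega>"
proof -
  have "AE \<omega> in M. \<forall>r::rat. 0 < real_of_rat r \<longrightarrow> ereal (real_of_rat r) < x \<longrightarrow> ereal (real_of_rat r) \<le> Y \<omega>"
    unfolding AE_all_countable using assms(2) by (auto intro!: AE_impI)
  with assms(1) show ?thesis
  proof eventually_elim
    case (elim \<omega>)
    show ?case
    proof (rule ccontr)
      assume "\<not> x \<le> Y \<omega>"
      then obtain r where r: "Y \<omega> < ereal (real_of_rat r)" "ereal (real_of_rat r) < x"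
        using ereal_dense3[of "Y \<omega>" x] unfolding not_le by blast
      then have "0 < ereal (real_of_rat r)" using elim(1) by (meson le_less_trans)
      then have "ereal (real_of_rat r) \<le> Y \<omega>" using r(2) elim(2) by simp
      with r(1) show False by simp
    qed
  qed
qed

section \<open>Choice of the exponents for d = 1 and for d at least 2\<close>

context standard_brownian_motion
begin

lemma AE_minkowski_dim_image_nonneg:
  assumes "cadlag f" "A \<subseteq> {0..1}" "A \<noteq> {}"
  shows "AE \<omega> in M. 0 \<le> lower_minkowski_dim ((\<lambda>t. B t \<omega> + f t) ` A)"
    "AE \<omega> in M. 0 \<le> upper_minkowski_dim ((\<lambda>t. B t \<omega> + f t) ` A)"
proof -
  show *: "AE \<omega> in M. 0 \<le> lower_minkowski_dim ((\<lambda>t. B t \<omega> + f t) ` A)"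
    using AE_bounded_image[OF assms(1,2)]
    by eventually_elim (use assms(3) in \<open>auto intro: lower_minkowski_dim_nonneg\<close>)
  show "AE \<omega> in M. 0 \<le> upper_minkowski_dim ((\<lambda>t. B t \<omega> + f t) ` A)"
    using * by eventually_elim (use lower_minkowski_dim_le_upper order_trans in blast)
qed

lemma AE_minkowski_dim_image_ge_dim1:
  assumes f: "cadlag f" and A: "A \<subseteq> {0..1}" "A \<noteq> {}"
  shows "AE \<omega> in M. 2 * lower_minkowski_dim A / (lower_minkowski_dim A + 1)
      \<le> lower_minkowski_dim ((\<lambda>t. B t \<omega> + f t) ` A)"
    and "AE \<omega> in M. 2 * upper_minkowski_dim A / (upper_minkowski_dim A + 1)
      \<le> upper_minkowski_dim ((\<lambda>t. B t \<omega> + f t) ` A)"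
proof -
  have bA: "bounded A" using A bounded_subset[OF bounded_closed_interval] by blast
  \<comment> \<open>With q = 1/2 and \<kappa> = a / c the condition on the exponents becomes (1 + a)
    / 2 < a / c, that is a > c / (2 - c), the inverse of x to 2 x / (x + 1).\<close>
  have exponent: "\<exists>a. 0 < a \<and> ereal a < D \<and> (1 + a) / 2 < a / c"
    if c: "0 < c" "ereal c < 2 * D / (D + 1)" and D: "0 \<le> D" for c D
  proof (cases D)
    case (real x)
    then have "0 \<le> x" using D by simp
    then have "c < 2 * x / (x + 1)" using c(2) unfolding real by simp
    then have "c * (x + 1) < 2 * x" using \<open>0 \<le> x\<close> by (simp add: pos_less_divide_eq)
    then have *: "c < (2 - c) * x" by (simp add: algebra_simps)
    then have "0 < (2 - c) * x" using c by linarith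
    then have "c < 2" using \<open>0 \<le> x\<close> by (simp add: zero_less_mult_iff)
    then have "c / (2 - c) < x" using * by (simp add: pos_divide_less_eq mult.commute)
    then obtain a where a: "c / (2 - c) < a" "a < x" using dense by blast
    have "0 < c / (2 - c)" using c \<open>c < 2\<close> by simp
    then have "0 < a" using a by linarith
    moreover have "c < a * (2 - c)" using a \<open>c < 2\<close> by (simp add: pos_divide_less_eq)
    then have "(1 + a) / 2 < a / c" using c by (simp add: field_simps)
    ultimately show ?thesis using a real by auto
  next
    case PInf
    \<comment> \<open>In \<open>ereal\<close> the quotient of infinity by infinity is 0, so this
      case would give c < 0.\<close>
    then show ?thesis using c by (simp add: divide_ereal_def)
  qed (use D in simp)
  have core: "AE \<omega> in M.
      (ereal a < lower_minkowski_dim A \<longrightarrow> ereal c \<le> lower_minkowski_dim ((\<lambda>t. B t \<omega> + f t) ` A)) \<and>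
      (ereal a < upper_minkowski_dim A \<longrightarrow> ereal c \<le> upper_minkowski_dim ((\<lambda>t. B t \<omega> + f t) ` A))"
    if "0 < c" "0 < a" "(1 + a) / 2 < a / c" for a c
    using AE_minkowski_dim_image_ge[OF f A, of a "a / c" "1 / 2"] that
    by (simp add: field_simps Suc_leI)
  show "AE \<omega> in M. 2 * lower_minkowski_dim A / (lower_minkowski_dim A + 1)
      \<le> lower_minkowski_dim ((\<lambda>t. B t \<omega> + f t) ` A)"
  proof (rule AE_ereal_leI[OF AE_minkowski_dim_image_nonneg(1)[OF f A]])
    fix c :: real
    assume c: "0 < c" "ereal c < 2 * lower_minkowski_dim A / (lower_minkowski_dim A + 1)"
    obtain a where a: "0 < a" "ereal a < lower_minkowski_dim A" "(1 + a) / 2 < a / c"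
      using exponent[OF c lower_minkowski_dim_nonneg[OF bA A(2)]] by blast
    show "AE \<omega> in M. ereal c \<le> lower_minkowski_dim ((\<lambda>t. B t \<omega> + f t) ` A)"
      using core[OF c(1) a(1,3)] by eventually_elim (use a(2) in blast)
  qed
  show "AE \<omega> in M. 2 * upper_minkowski_dim A / (upper_minkowski_dim A + 1)
      \<le> upper_minkowski_dim ((\<lambda>t. B t \<omega> + f t) ` A)"
  proof (rule AE_ereal_leI[OF AE_minkowski_dim_image_nonneg(2)[OF f A]])
    fix c :: real
    assume c: "0 < c" "ereal c < 2 * upper_minkowski_dim A / (upper_minkowski_dim A + 1)"
    have "0 \<le> upper_minkowski_dim A"
      using lower_minkowski_dim_nonneg[OF bA A(2)] lower_minkowski_dim_le_upper order_trans by blast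
    then obtain a where a: "0 < a" "ereal a < upper_minkowski_dim A" "(1 + a) / 2 < a / c"
      using exponent[OF c] by blast
    show "AE \<omega> in M. ereal c \<le> upper_minkowski_dim ((\<lambda>t. B t \<omega> + f t) ` A)"
      using core[OF c(1) a(1,3)] by eventually_elim (use a(2) in blast)
  qed
qed

lemma AE_minkowski_dim_image_ge_dim2:
  assumes f: "cadlag f" and A: "A \<subseteq> {0..1}" "A \<noteq> {}" and d: "2 \<le> CARD('d)"
  shows "AE \<omega> in M. 2 * lower_minkowski_dim A \<le> lower_minkowski_dim ((\<lambda>t. B t \<omega> + f t) ` A)"
    and "AE \<omega> in M. 2 * upper_minkowski_dim A \<le> upper_minkowski_dim ((\<lambda>t. B t \<omega> + f t) ` A)"
proof -
  have exponent: "\<exists>a. c / 2 < a \<and> ereal a < D" if "ereal c < 2 * D" for c D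
  proof -
    have "ereal (c / 2) < D" using that by (cases D) auto
    then show ?thesis using ereal_dense2 by fastforce
  qed
  have core: "AE \<omega> in M.
      (ereal a < lower_minkowski_dim A \<longrightarrow> ereal c \<le> lower_minkowski_dim ((\<lambda>t. B t \<omega> + f t) ` A)) \<and>
      (ereal a < upper_minkowski_dim A \<longrightarrow> ereal c \<le> upper_minkowski_dim ((\<lambda>t. B t \<omega> + f t) ` A))"
    if "0 < c" "c / 2 < a" for a c
  proof -
    define \<kappa> where "\<kappa> = a / c"
    have "0 < a" using that by simp
    have "1 < 2 * \<kappa>" unfolding \<kappa>_def using that by (simp add: field_simps)
    \<comment> \<open>The left side is the value of q at which q + a * (1 - q) = 2 * q * \<kappa>;
      it is below 1 because 2 * \<kappa> > 1, so an admissible q remains.\<close>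
    then have "a / (2 * \<kappa> - 1 + a) < 1" using \<open>0 < a\<close> by simp
    then obtain q where q: "a / (2 * \<kappa> - 1 + a) < q" "q < 1" using dense by blast
    have "0 < a / (2 * \<kappa> - 1 + a)" using \<open>0 < a\<close> \<open>1 < 2 * \<kappa>\<close> by simp
    then have "0 < q" using q by linarith
    have "a < q * (2 * \<kappa> - 1 + a)" using q(1) \<open>0 < a\<close> \<open>1 < 2 * \<kappa>\<close> by (simp add: pos_divide_less_eq)
    then have "q + a * (1 - q) < 2 * q * \<kappa>" by (simp add: algebra_simps)
    moreover have "2 * q \<le> real CARD('d)" using q d by linarith
    moreover have "a / \<kappa> = c" unfolding \<kappa>_def using that by simp
    ultimately show ?thesis
      using AE_minkowski_dim_image_ge[OF f A, of a \<kappa> q] \<open>0 < a\<close> \<open>0 < q\<close> q(2) \<open>1 < 2 * \<kappa>\<close> by simp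
  qed
  show "AE \<omega> in M. 2 * lower_minkowski_dim A \<le> lower_minkowski_dim ((\<lambda>t. B t \<omega> + f t) ` A)"
  proof (rule AE_ereal_leI[OF AE_minkowski_dim_image_nonneg(1)[OF f A]])
    fix c :: real assume c: "0 < c" "ereal c < 2 * lower_minkowski_dim A"
    then obtain a where a: "c / 2 < a" "ereal a < lower_minkowski_dim A" using exponent by blast
    show "AE \<omega> in M. ereal c \<le> lower_minkowski_dim ((\<lambda>t. B t \<omega> + f t) ` A)"
      using core[OF c(1) a(1)] by eventually_elim (use a(2) in blast)
  qed
  show "AE \<omega> in M. 2 * upper_minkowski_dim A \<le> upper_minkowski_dim ((\<lambda>t. B t \<omega> + f t) ` A)"
  proof (rule AE_ereal_leI[OF AE_minkowski_dim_image_nonneg(2)[OF f A]])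
    fix c :: real assume c: "0 < c" "ereal c < 2 * upper_minkowski_dim A"
    then obtain a where a: "c / 2 < a" "ereal a < upper_minkowski_dim A" using exponent by blast
    show "AE \<omega> in M. ereal c \<le> upper_minkowski_dim ((\<lambda>t. B t \<omega> + f t) ` A)"
      using core[OF c(1) a(1)] by eventually_elim (use a(2) in blast)
  qed
qed

end

section \<open>Sharpness in dimension one\<close>

lemma packing_number_le_of_isometric_real:
  fixes E :: "'a::euclidean_space set" and g :: "'a \<Rightarrow> real"
  assumes g: "\<And>x y. dist x y = \<bar>g x - g y\<bar>"
    and E: "bounded E" and G: "finite G" "card G \<le> m" and "0 \<le> R" "0 < e"
    and R: "\<And>x. x \<in> E - G \<Longrightarrow> \<bar>g x\<bar> \<le> R"
  shows "real (packing_number E e) \<le> real m + R / e + 1"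
proof -
  obtain S where S: "S \<subseteq> E" "finite S" "card S = packing_number E e"
    "\<And>x y. x \<in> S \<Longrightarrow> y \<in> S \<Longrightarrow> x \<noteq> y \<Longrightarrow> 2 * e \<le> dist x y"
    using packing_number_attained[OF E \<open>0 < e\<close>] by blast
  \<comment> \<open>Index of the cell of length 2 e containing \<open>g x\<close> in [-R, R];
    separated points never share a cell. Adding \<open>R\<close> keeps the quotient nonnegative
    before \<open>nat\<close> is applied. Since 2 R / (2 e) = R / e, the indices start at 0 and end
    at the floor of R / e, whence the final + 1.\<close>
  define k where "k x = nat \<lfloor>(g x + R) / (2 * e)\<rfloor>" for x
  have k: "real (k x) \<le> (g x + R) / (2 * e)" "(g x + R) / (2 * e) < real (k x) + 1"
    if "x \<in> S - G" for x
  proof -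
    have "\<bar>g x\<bar> \<le> R" using that R S(1) by blast
    then have "0 \<le> (g x + R) / (2 * e)" using \<open>0 < e\<close> by simp
    then show "real (k x) \<le> (g x + R) / (2 * e)" "(g x + R) / (2 * e) < real (k x) + 1"
      unfolding k_def by linarith+
  qed
  have "inj_on k (S - G)"
  proof (rule inj_onI, rule ccontr)
    fix x y assume xy: "x \<in> S - G" "y \<in> S - G" "k x = k y" "x \<noteq> y"
    have "\<bar>(g x + R) / (2 * e) - (g y + R) / (2 * e)\<bar> < 1"
      using k[OF xy(1)] k[OF xy(2)] xy(3) by linarith
    then have "\<bar>g x - g y\<bar> < 2 * e"
      using \<open>0 < e\<close> by (simp add: diff_divide_distrib[symmetric])
    then show False using S(4)[of x y] xy g[of x y] by auto
  qed
  moreover have "k ` (S - G) \<subseteq> {..nat \<lfloor>R / e\<rfloor>}"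
  proof (rule image_subsetI)
    fix x assume x: "x \<in> S - G"
    then have "\<bar>g x\<bar> \<le> R" using R S(1) by blast
    then have "(g x + R) / (2 * e) \<le> R / e" using \<open>0 < e\<close> by (simp add: field_simps)
    then have "real (k x) \<le> R / e" using k(1)[OF x] by linarith
    then show "k x \<in> {..nat \<lfloor>R / e\<rfloor>}" by (simp add: le_nat_floor)
  qed
  ultimately have "card (S - G) \<le> card {..nat \<lfloor>R / e\<rfloor>}"
    by (intro card_inj_on_le[of k]) auto
  then have "card (S - G) \<le> Suc (nat \<lfloor>R / e\<rfloor>)" by simp
  moreover have "card S \<le> card (S - G) + m"
    using diff_card_le_card_Diff[OF G(1), of S] G(2) by linarith
  moreover have "real (nat \<lfloor>R / e\<rfloor>) \<le> R / e" using \<open>0 \<le> R\<close> \<open>0 < e\<close> by (simp add: of_nat_floor)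
  ultimately show ?thesis using S(3) by linarith
qed

text \<open>Removing m points leaves a set of radius C * m powr - a, so the packing number is at
  most m + C * m powr - a / e + 1. The two main terms balance at m of order (1 / e) powr (1 / (1 +
  a)). The map \<open>g\<close> stands for the identity on the reals or for the only coordinate of a
  one-dimensional vector.\<close>

lemma upper_minkowski_dim_le_of_decay:
  fixes E :: "'a::euclidean_space set" and g :: "'a \<Rightarrow> real"
  assumes g: "\<And>x y. dist x y = \<bar>g x - g y\<bar>"
    and E: "bounded E" "E \<noteq> {}" and "0 \<le> a" "0 \<le> C"
    and decay: "\<And>m. 1 \<le> m \<Longrightarrow> \<exists>G. finite G \<and> card G \<le> m \<and> (\<forall>x\<in>E - G. \<bar>g x\<bar> \<le> C * real m powr - a)"
  shows "upper_minkowski_dim E \<le> ereal (1 / (1 + a))"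
proof (rule upper_minkowski_dim_leI[OF E])
  \<comment> \<open>The 3 collects m \<le> u + 1 and the additive 1 of the packing bound, using u
    \<ge> 1.\<close>
  show "0 < 3 + C" using \<open>0 \<le> C\<close> by simp
  fix e :: real assume e: "0 < e" "e < 1"
  define b where "b = 1 / (1 + a)"
  have b: "0 < b" "1 - a * b = b" unfolding b_def using \<open>0 \<le> a\<close> by (auto simp: field_simps)
  define u where "u = (1 / e) powr b"
  have "1 \<le> u" unfolding u_def using e b by (intro ge_one_powr_ge_zero) auto
  define m where "m = nat \<lceil>u\<rceil>"
  have m: "u \<le> real m" "real m \<le> u + 1" "1 \<le> m" unfolding m_def using \<open>1 \<le> u\<close> by linarith+
  obtain G where G: "finite G" "card G \<le> m" "\<And>x. x \<in> E - G \<Longrightarrow> \<bar>g x\<bar> \<le> C * real m powr - a"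
    using decay[OF m(3)] by blast
  have "real (packing_number E e) \<le> real m + C * real m powr - a / e + 1"
    using packing_number_le_of_isometric_real[OF g E(1) G(1,2) _ e(1) G(3)] \<open>0 \<le> C\<close> by simp
  also have "C * real m powr - a / e \<le> C * u powr - a / e"
    using m \<open>1 \<le> u\<close> \<open>0 \<le> a\<close> \<open>0 \<le> C\<close> e by (intro divide_right_mono mult_left_mono powr_mono2') auto
  also have "u powr - a / e = u"
  proof -
    have "u powr - a / e = (1 / e) powr (- (a * b)) * (1 / e) powr 1"
      unfolding u_def using e by (simp add: powr_powr mult.commute)
    also have "\<dots> = (1 / e) powr (1 - a * b)" by (simp only: powr_add[symmetric]) simp
    finally show ?thesis unfolding b(2) u_def .
  qed
  then have "C * u powr - a / e = C * u" by (metis times_divide_eq_right)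
  finally show "real (packing_number E e) \<le> (3 + C) * (1 / e) powr (1 / (1 + a))"
    using m(2) \<open>1 \<le> u\<close> unfolding u_def b_def by (simp add: algebra_simps)
qed

section \<open>The model set: a power sequence and its dimension\<close>

definition power_sequence :: "real \<Rightarrow> nat \<Rightarrow> real" where
  "power_sequence p n = real (Suc n) powr - p"

lemma power_sequence_in_Icc: "0 \<le> p \<Longrightarrow> power_sequence p n \<in> {0..1}"
  using powr_mono2'[of "-p" 1 "real (Suc n)"] unfolding power_sequence_def
  by simp

lemma power_sequence_pos: "0 < power_sequence p n"
  unfolding power_sequence_def by simp

text \<open>By the mean value theorem the gap is (j - i) * p * z powr (- p - 1) for some z < M,
  hence at least the modulus of the derivative at \<open>M\<close>.\<close>

lemma power_sequence_gap:
  assumes "0 < p" "i < M" "j < M" "i \<noteq> j"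
  shows "p * real M powr - (p + 1) \<le> dist (power_sequence p i) (power_sequence p j)"
proof -
  have less: "p * real M powr - (p + 1) \<le> power_sequence p i - power_sequence p j"
    if "i < j" "j < M" for i j
  proof -
    have "\<exists>z. real (Suc i) < z \<and> z < real (Suc j) \<and>
        real (Suc j) powr - p - real (Suc i) powr - p = (real (Suc j) - real (Suc i)) * (- p * z powr (- p - 1))"
      using that(1) by (intro MVT2) (auto intro!: derivative_eq_intros)
    then obtain z where z: "real (Suc i) < z" "z < real (Suc j)"
      "power_sequence p i - power_sequence p j = (real j - real i) * (p * z powr (- p - 1))"
      unfolding power_sequence_def by (auto simp: algebra_simps)
    have "real M powr - (p + 1) \<le> z powr - (p + 1)"
      using z that assms(1) by (intro powr_mono2') auto
    then have "1 * (p * real M powr - (p + 1)) \<le> (real j - real i) * (p * z powr - (p + 1))"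
      using that assms(1) by (intro mult_mono mult_left_mono) auto
    then show ?thesis using z(3) by simp
  qed
  show ?thesis
  proof (cases "i < j")
    case True
    then show ?thesis using less[of i j] assms by (simp add: dist_real_def)
  next
    case False
    then show ?thesis using less[of j i] assms by (simp add: dist_real_def)
  qed
qed

text \<open>From above, the tail after m points has size m powr - p. From below, the initial 2 ^ m
  points have gaps of order 2 powr (- (p + 1) * m) and so form a packing at about that
  scale.\<close>

lemma minkowski_dim_power_sequence:
  assumes "0 < p"
  shows "lower_minkowski_dim (range (power_sequence p)) = ereal (1 / (1 + p))"
    and "upper_minkowski_dim (range (power_sequence p)) = ereal (1 / (1 + p))"
proof -
  let ?A = "range (power_sequence p)"
  have "?A \<subseteq> {0..1}" using power_sequence_in_Icc assms by (auto simp del: atLeastAtMost_iff)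
  then have bA: "bounded ?A" using bounded_subset[OF bounded_closed_interval] by blast
  have "upper_minkowski_dim ?A \<le> ereal (1 / (1 + p))"
  proof (rule upper_minkowski_dim_le_of_decay[where g = "\<lambda>x. x" and C = 1])
    fix m :: nat assume "1 \<le> m"
    show "\<exists>G. finite G \<and> card G \<le> m \<and> (\<forall>x\<in>?A - G. \<bar>x\<bar> \<le> 1 * real m powr - p)"
    proof (intro exI[of _ "power_sequence p ` {..<m}"] conjI ballI)
      show "card (power_sequence p ` {..<m}) \<le> m" using card_image_le[of "{..<m}"] by simp
      fix x assume "x \<in> ?A - power_sequence p ` {..<m}"
      then obtain n where "x = power_sequence p n" "m \<le> n" by (auto simp: not_less[symmetric])
      then show "\<bar>x\<bar> \<le> 1 * real m powr - p"
        using \<open>1 \<le> m\<close> assms unfolding power_sequence_def by (simp add: powr_mono2')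
    qed simp
  qed (use bA assms in \<open>auto simp: dist_real_def\<close>)
  moreover have "ereal (1 / (1 + p)) \<le> lower_minkowski_dim ?A"
  proof (rule ccontr)
    assume "\<not> ?thesis"
    then obtain y where y: "lower_minkowski_dim ?A < ereal y" "ereal y < ereal (1 / (1 + p))"
      using ereal_dense2 unfolding not_le by blast
    have "0 < ereal y" using le_less_trans[OF lower_minkowski_dim_nonneg[OF bA] y(1)] by simp
    then have "0 < y" by simp
    \<comment> \<open>The scale 2 powr - (m / y) is smaller than the gaps by a factor 2 powr -
      (\<eta> * m), up to constants; this eventually absorbs the constant 2 / p.\<close>
    define \<eta> where "\<eta> = 1 / y - (p + 1)"
    have "0 < \<eta>" unfolding \<eta>_def using y(2) \<open>0 < y\<close> assms by (simp add: field_simps)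
    have "filterlim (\<lambda>m. 2 powr (\<eta> * real m)) at_top sequentially"
      using \<open>0 < \<eta>\<close> by real_asymp
    then have "\<forall>\<^sub>F m in sequentially. 2 / p \<le> 2 powr (\<eta> * real m)"
      by (simp add: filterlim_at_top)
    then have "\<forall>\<^sub>F m in sequentially. 1 * 2 powr (1 * real m) \<le> real (packing_number ?A (2 powr - (1 / y * real m)))"
    proof eventually_elim
      case (elim m)
      have *: "2 * 2 powr - (1 / y * real m) \<le> p * (2 ^ m) powr - (p + 1)"
      proof -
        have "1 / y * real m = \<eta> * real m + (p + 1) * real m" unfolding \<eta>_def by (simp add: algebra_simps)
        then have "2 * 2 powr - (1 / y * real m) = 2 / 2 powr (\<eta> * real m) * 2 powr (- ((p + 1) * real m))"
          by (simp add: powr_add powr_diff powr_minus_divide)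
        also have "\<dots> \<le> p * 2 powr (- ((p + 1) * real m))"
          using elim assms by (intro mult_right_mono) (auto simp: field_simps)
        also have "2 powr (- ((p + 1) * real m)) = (2 ^ m) powr - (p + 1)"
          by (simp add: powr_powr algebra_simps flip: powr_realpow)
        finally show ?thesis .
      qed
      have gap: "2 * 2 powr - (1 / y * real m) \<le> dist (power_sequence p i) (power_sequence p j)"
        if "i < 2 ^ m" "j < 2 ^ m" "i \<noteq> j" for i j
        using * power_sequence_gap[OF assms that] by simp
      have "inj_on (power_sequence p) {..<2 ^ m}"
      proof (rule inj_onI, rule ccontr)
        fix i j assume ij: "i \<in> {..<2 ^ m}" "j \<in> {..<2 ^ m}" "power_sequence p i = power_sequence p j" "i \<noteq> j"
        have "(0::real) < 2 powr - (1 / y * real m)" by simp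
        then show False using gap[of i j] ij by simp
      qed
      then have "card (power_sequence p ` {..<2 ^ m}) = 2 ^ m" by (simp add: card_image)
      moreover have "card (power_sequence p ` {..<2 ^ m}) \<le> packing_number ?A (2 powr - (1 / y * real m))"
        by (rule packing_number_ge[OF bA]) (use gap in auto)
      ultimately have "2 ^ m \<le> packing_number ?A (2 powr - (1 / y * real m))" by simp
      then have "real (2 ^ m) \<le> real (packing_number ?A (2 powr - (1 / y * real m)))" by (rule of_nat_mono)
      then show ?case by (simp add: powr_realpow)
    qed
    then have "ereal (1 / (1 / y)) \<le> lower_minkowski_dim ?A"
      using \<open>0 < y\<close> by (intro lower_minkowski_dim_geI[OF bA, of 1]) auto
    then show False using y(1) by simp
  qed
  ultimately show "lower_minkowski_dim ?A = ereal (1 / (1 + p))"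
    "upper_minkowski_dim ?A = ereal (1 / (1 + p))"
    using lower_minkowski_dim_le_upper[of ?A] by auto
qed

text \<open>The case without decay: exponent 0, and no points removed.\<close>

lemma upper_minkowski_dim_le_1:
  fixes E :: "'a::euclidean_space set" and g :: "'a \<Rightarrow> real"
  assumes g: "\<And>x y. dist x y = \<bar>g x - g y\<bar>" and E: "bounded E" "E \<noteq> {}"
  shows "upper_minkowski_dim E \<le> 1"
proof -
  obtain x0 where "x0 \<in> E" using E by blast
  obtain K where K: "\<And>x. x \<in> E \<Longrightarrow> dist x0 x \<le> K" using E(1) bounded_any_center[of E x0] by blast
  have "\<bar>g x\<bar> \<le> \<bar>g x0\<bar> + K" if "x \<in> E" for x using K[OF that] g[of x0 x] by linarith
  then have "upper_minkowski_dim E \<le> ereal (1 / (1 + 0))"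
    using K[OF \<open>x0 \<in> E\<close>] E
    by (intro upper_minkowski_dim_le_of_decay[OF g, of E 0 "\<bar>g x0\<bar> + K"])
       (auto intro!: exI[of _ "{}"])
  then show ?thesis by (simp add: one_ereal_def[symmetric])
qed

lemma minkowski_dim_unit_interval:
  "lower_minkowski_dim {0..1::real} = 1" "upper_minkowski_dim {0..1::real} = 1"
proof -
  have "\<forall>\<^sub>F m in sequentially. 1 / 2 * 2 powr (1 * real m) \<le> real (packing_number {0..1::real} (2 powr - (1 * real m)))"
    using eventually_ge_at_top[of 1]
  proof eventually_elim
    case (elim m)
    then obtain k where m: "m = Suc k" using Suc_le_D by auto
    \<comment> \<open>The spacing 1 / 2 ^ k is exactly twice the radius 2 powr - m because m = k +
      1; the resulting 2 ^ k points account for the constant 1/2.\<close>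
    define h where "h j = real j / 2 ^ k" for j :: nat
    have r: "2 powr - (1 * real m) = 1 / (2 * 2 ^ k)"
      unfolding m by (simp add: powr_minus_divide powr_realpow flip: of_nat_Suc)
    have "inj_on h {..<2 ^ k}" unfolding h_def by (auto simp: inj_on_def)
    moreover have "card (h ` {..<2 ^ k}) \<le> packing_number {0..1::real} (2 powr - (1 * real m))"
    proof (rule packing_number_ge)
      show "h ` {..<2 ^ k} \<subseteq> {0..1}"
      proof clarify
        fix j :: nat assume "j < 2 ^ k"
        then have "real j \<le> 2 ^ k" by (metis less_imp_le of_nat_le_iff of_nat_numeral of_nat_power)
        then show "h j \<in> {0..1}" unfolding h_def by simp
      qed
      fix x y assume "x \<in> h ` {..<2 ^ k}" "y \<in> h ` {..<2 ^ k}" "x \<noteq> y"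
      then obtain i j where ij: "x = h i" "y = h j" "i \<noteq> j" by blast
      have "1 \<le> \<bar>real i - real j\<bar>" using ij(3) by linarith
      then show "2 * 2 powr - (1 * real m) \<le> dist x y"
        unfolding r ij h_def dist_real_def by (simp add: diff_divide_distrib[symmetric] abs_divide divide_right_mono)
    qed auto
    ultimately have "2 ^ k \<le> packing_number {0..1::real} (2 powr - (1 * real m))"
      by (simp add: card_image)
    then have "real (2 ^ k) \<le> real (packing_number {0..1::real} (2 powr - (1 * real m)))" by (rule of_nat_mono)
    then show ?case unfolding m by (simp add: powr_realpow powr_add)
  qed
  then have "ereal (1 / 1) \<le> lower_minkowski_dim {0..1::real}"
    by (intro lower_minkowski_dim_geI[of _ "1 / 2"]) auto
  moreover have "upper_minkowski_dim {0..1::real} \<le> 1"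
    by (rule upper_minkowski_dim_le_1[of "\<lambda>x. x"]) (auto simp: dist_real_def)
  ultimately show "lower_minkowski_dim {0..1::real} = 1" "upper_minkowski_dim {0..1::real} = 1"
    using lower_minkowski_dim_le_upper[of "{0..1::real}"] by (auto simp: one_ereal_def[symmetric])
qed

lemma minkowski_dim_singleton:
  fixes x :: "'a::euclidean_space"
  shows "lower_minkowski_dim {x} = 0" "upper_minkowski_dim {x} = 0"
proof -
  have "upper_minkowski_dim {x} \<le> ereal 0"
  proof (rule upper_minkowski_dim_leI[where c = 1])
    fix e :: real assume e: "0 < e" "e < 1"
    have b: "bounded {x}" by simp
    obtain S where "S \<subseteq> {x}" "card S = packing_number {x} e"
      by (rule packing_number_attained[OF b e(1)]) (rule that)
    then have "packing_number {x} e \<le> 1" using card_mono[of "{x}" S] by simp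
    then show "real (packing_number {x} e) \<le> 1 * (1 / e) powr 0" using e by simp
  qed auto
  then show "lower_minkowski_dim {x} = 0" "upper_minkowski_dim {x} = 0"
    using lower_minkowski_dim_le_upper[of "{x}"] lower_minkowski_dim_nonneg[of "{x}"]
    by (auto simp: zero_ereal_def[symmetric])
qed

text \<open>Markov's inequality for the moment of order 2 k; the constant is the corresponding
  moment of a standard Gaussian. A polynomial tail of arbitrary order is enough for the summability
  needed below.\<close>

lemma nn_integral_normal_density_tail:
  assumes "0 < \<sigma>" "0 < x"
  shows "(\<integral>\<^sup>+y. ennreal (normal_density 0 \<sigma> y) * indicator {y. x \<le> \<bar>y\<bar>} y \<partial>lborel)
    \<le> ennreal (fact (2 * k) / (2 ^ k * fact k) * (\<sigma> / x) ^ (2 * k))"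
proof -
  let ?g = "\<lambda>y. normal_density 0 \<sigma> y * y ^ (2 * k)"
  have moment: "has_bochner_integral lborel ?g (fact (2 * k) / ((2 / \<sigma>\<^sup>2) ^ k * fact k))"
    using normal_moment_even[OF assms(1), of 0 k] by simp
  have nonneg: "0 \<le> ?g y" for y by (simp add: power_mult)
  have "(\<integral>\<^sup>+y. ennreal (normal_density 0 \<sigma> y) * indicator {y. x \<le> \<bar>y\<bar>} y \<partial>lborel)
      \<le> (\<integral>\<^sup>+y. ennreal (1 / x ^ (2 * k)) * ennreal (?g y) \<partial>lborel)"
  proof (rule nn_integral_mono)
    fix y
    have "normal_density 0 \<sigma> y \<le> 1 / x ^ (2 * k) * ?g y" if "x \<le> \<bar>y\<bar>"
    proof -
      have "x ^ (2 * k) \<le> \<bar>y\<bar> ^ (2 * k)" using that assms by (intro power_mono) auto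
      then have "1 \<le> y ^ (2 * k) / x ^ (2 * k)" using assms by (simp add: power_even_abs)
      then have "normal_density 0 \<sigma> y * 1 \<le> normal_density 0 \<sigma> y * (y ^ (2 * k) / x ^ (2 * k))"
        by (intro mult_left_mono) auto
      then show ?thesis by (simp add: mult.commute)
    qed
    then show "ennreal (normal_density 0 \<sigma> y) * indicator {y. x \<le> \<bar>y\<bar>} y
        \<le> ennreal (1 / x ^ (2 * k)) * ennreal (?g y)"
      using assms by (auto simp: ennreal_mult[symmetric] nonneg intro!: ennreal_leI split: split_indicator)
  qed
  also have "\<dots> = ennreal (1 / x ^ (2 * k)) * ennreal (fact (2 * k) / ((2 / \<sigma>\<^sup>2) ^ k * fact k))"
    using moment nonneg
    by (subst nn_integral_cmult)
       (auto simp: has_bochner_integral_iff nn_integral_eq_integral)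
  also have "\<dots> = ennreal (fact (2 * k) / (2 ^ k * fact k) * (\<sigma> / x) ^ (2 * k))"
    using assms by (subst ennreal_mult[symmetric]) (auto simp: power_divide field_simps simp flip: power_mult)
  finally show ?thesis .
qed

lemma AE_ereal_geI:
  fixes Y :: "'w \<Rightarrow> ereal"
  assumes "\<And>c::real. x < ereal c \<Longrightarrow> AE \<omega> in M. Y \<omega> \<le> ereal c"
  shows "AE \<omega> in M. Y \<omega> \<le> x"
proof -
  have "AE \<omega> in M. \<forall>r::rat. x < ereal (real_of_rat r) \<longrightarrow> Y \<omega> \<le> ereal (real_of_rat r)"
    unfolding AE_all_countable using assms by (auto intro!: AE_impI)
  then show ?thesis
  proof eventually_elim
    case (elim \<omega>)
    show ?case
    proof (rule ccontr)
      assume "\<not> Y \<omega> \<le> x"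
      then obtain r where "x < ereal (real_of_rat r)" "ereal (real_of_rat r) < Y \<omega>"
        using ereal_dense3[of x "Y \<omega>"] unfolding not_le by blast
      moreover from this have "Y \<omega> \<le> ereal (real_of_rat r)" using elim by blast
      ultimately show False by simp
    qed
  qed
qed

section \<open>Brownian motion along the power sequence\<close>

context standard_brownian_motion
begin

text \<open>The condition on \<open>UNIV\<close> encodes d = 1 and names the only coordinate, so the
  joint density is a single Gaussian factor.\<close>

lemma prob_component_increment_tail:
  assumes UNIV: "(UNIV :: 'd set) = {i}" and st: "0 \<le> s" "s < t" and "0 < x"
  shows "prob {\<omega> \<in> space M. x \<le> \<bar>B t \<omega> $ i - B s \<omega> $ i\<bar>}
    \<le> fact (2 * k) / (2 ^ k * fact k) * (sqrt (t - s) / x) ^ (2 * k)"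
proof -
  define \<sigma> where "\<sigma> = sqrt (t - s)"
  have "0 < \<sigma>" unfolding \<sigma>_def using st by simp
  have Basis: "(Basis :: (real ^ 'd) set) = {axis i 1}"
    by (auto simp: Basis_vec_def UNIV)
  let ?f = "\<lambda>b y. ennreal (normal_density 0 \<sigma> y) * indicator {y. x \<le> \<bar>y\<bar>} y"
  let ?S = "{v :: real ^ 'd. x \<le> \<bar>v $ i\<bar>}"
  have *: "{\<omega> \<in> space M. x \<le> \<bar>B t \<omega> $ i - B s \<omega> $ i\<bar>} = (\<lambda>\<omega>. B t \<omega> - B s \<omega>) -` ?S \<inter> space M"
    by auto
  have [measurable]: "(\<lambda>v :: real ^ 'd. v $ i) \<in> borel_measurable borel"
    by (intro borel_measurable_continuous_onI continuous_intros)
  have "emeasure M {\<omega> \<in> space M. x \<le> \<bar>B t \<omega> $ i - B s \<omega> $ i\<bar>}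
      = (\<integral>\<^sup>+v. ennreal (\<Prod>j\<in>UNIV. normal_density 0 \<sigma> (v $ j)) * indicator ?S v \<partial>lborel)"
    unfolding * \<sigma>_def by (rule distributed_emeasure[OF gaussian_increments[OF st]]) measurable
  also have "\<dots> = (\<integral>\<^sup>+v. (\<Prod>b\<in>(Basis :: (real ^ 'd) set). ?f b (v \<bullet> b)) \<partial>lborel)"
    by (intro nn_integral_cong) (simp add: UNIV Basis inner_axis indicator_def)
  also have "\<dots> = (\<Prod>b\<in>(Basis :: (real ^ 'd) set). \<integral>\<^sup>+y. ?f b y \<partial>lborel)"
    by (intro nn_integral_lborel_prod) auto
  also have "\<dots> \<le> ennreal (fact (2 * k) / (2 ^ k * fact k) * (\<sigma> / x) ^ (2 * k))"
    unfolding Basis using nn_integral_normal_density_tail[OF \<open>0 < \<sigma>\<close> \<open>0 < x\<close>, of k] by simp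
  finally show ?thesis
    using \<open>0 < x\<close> \<open>0 < \<sigma>\<close> unfolding \<sigma>_def[symmetric]
    by (simp add: emeasure_eq_measure)
qed

text \<open>At the n-th time the standard deviation is (n + 1) powr (- p / 2). Exceeding it by a
  factor (n + 1) powr \<eta> has probability of order (n + 1) powr (- 2 k \<eta>), which is summable
  for a large moment order k.\<close>

lemma AE_power_sequence_decay:
  assumes UNIV: "(UNIV :: 'd set) = {i}" and "0 < \<eta>"
  shows "AE \<omega> in M. \<exists>C\<ge>0. \<forall>n. \<bar>B (power_sequence p n) \<omega> $ i\<bar> \<le> C * real (Suc n) powr - (p / 2 - \<eta>)"
proof -
  obtain k :: nat where "1 / \<eta> < real k" using reals_Archimedean2 by blast
  then have k: "1 < real k * \<eta>" using \<open>0 < \<eta>\<close> by (simp add: pos_divide_less_eq)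
  define c :: real where "c = fact (2 * k) / (2 ^ k * fact k)"
  define b where "b n = real (Suc n) powr - (p / 2 - \<eta>)" for n
  have "0 < b n" for n unfolding b_def by simp
  \<comment> \<open>The locale gives the law of increments, so \<open>B 0\<close> is subtracted
    here; it vanishes almost surely.\<close>
  define F where "F n = {\<omega> \<in> space M. b n \<le> \<bar>B (power_sequence p n) \<omega> $ i - B 0 \<omega> $ i\<bar>}" for n
  have F: "F n \<in> sets M" for n
  proof -
    have [measurable]: "B (power_sequence p n) \<in> borel_measurable M" "B 0 \<in> borel_measurable M"
      using power_sequence_pos[of p n] by (auto intro: measurable_B less_imp_le)
    have [measurable]: "(\<lambda>v :: real ^ 'd. v $ i) \<in> borel_measurable borel"
      by (intro borel_measurable_continuous_onI continuous_intros)
    show ?thesis unfolding F_def by measurable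
  qed
  have PF: "prob (F n) \<le> c * real (Suc n) powr (- 2 * real k * \<eta>)" for n
  proof -
    have "prob (F n) \<le> c * (sqrt (power_sequence p n - 0) / b n) ^ (2 * k)"
      unfolding F_def c_def
      by (rule prob_component_increment_tail[OF UNIV order_refl power_sequence_pos \<open>0 < b n\<close>])
    also have "sqrt (power_sequence p n - 0) / b n = real (Suc n) powr - \<eta>"
    proof -
      have "sqrt (power_sequence p n - 0) = real (Suc n) powr (- p * (1 / 2))"
        unfolding power_sequence_def powr_powr[symmetric] by (simp add: powr_half_sqrt)
      then have "sqrt (power_sequence p n - 0) / b n = real (Suc n) powr (- p * (1 / 2) - - (p / 2 - \<eta>))"
        unfolding b_def by (simp only: powr_diff)
      then show ?thesis by simp
    qed
    also have "(real (Suc n) powr - \<eta>) ^ (2 * k) = real (Suc n) powr (- 2 * real k * \<eta>)"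
      by (simp add: powr_power mult_ac)
    finally show ?thesis .
  qed
  have "summable (\<lambda>n. real n powr (- 2 * real k * \<eta>))"
    using summable_real_powr_iff[of "- 2 * real k * \<eta>"] k by simp
  then have "summable (\<lambda>n. real (Suc n) powr (- 2 * real k * \<eta>))"
    using summable_Suc_iff[of "\<lambda>n. real n powr (- 2 * real k * \<eta>)"] by blast
  then have "summable (\<lambda>n. c * real (Suc n) powr (- 2 * real k * \<eta>))" by (rule summable_mult)
  then have "summable (\<lambda>n. prob (F n))"
    by (rule summable_comparison_test') (use PF in simp)
  then have "AE \<omega> in M. \<forall>\<^sub>F n in sequentially. \<omega> \<in> space M - F n"
    using F by (intro borel_cantelli_AE1) (auto simp: less_top[symmetric])
  with start_zero show ?thesis
  proof eventually_elim
    case (elim \<omega>)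
    have "\<forall>\<^sub>F n in sequentially. norm (B (power_sequence p n) \<omega> $ i / b n) \<le> 1"
      using elim(2)
    proof eventually_elim
      case (elim n)
      then have "\<bar>B (power_sequence p n) \<omega> $ i\<bar> \<le> b n"
        unfolding F_def using \<open>B 0 \<omega> = 0\<close> by auto
      then show ?case using \<open>0 < b n\<close> by (simp add: abs_divide)
    qed
    \<comment> \<open>The finitely many exceptional indices only enlarge the constant, which
      therefore depends on \<omega>.\<close>
    then have "Bseq (\<lambda>n. B (power_sequence p n) \<omega> $ i / b n)" by (rule BfunI)
    then obtain C where C: "0 < C" "\<And>n. norm (B (power_sequence p n) \<omega> $ i / b n) \<le> C"
      using BseqD by blast
    have "\<bar>B (power_sequence p n) \<omega> $ i\<bar> \<le> C * b n" for n
      using C(2)[of n] \<open>0 < b n\<close> by (simp add: abs_divide pos_divide_le_eq)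
    then show ?case using C(1) unfolding b_def by (intro exI[of _ C]) auto
  qed
qed

lemma AE_upper_minkowski_dim_image_power_sequence_le:
  assumes UNIV: "(UNIV :: 'd set) = {i}" and "0 < p"
  shows "AE \<omega> in M. upper_minkowski_dim ((\<lambda>t. B t \<omega>) ` range (power_sequence p)) \<le> ereal (1 / (1 + p / 2))"
proof (rule AE_ereal_geI)
  fix c assume "ereal (1 / (1 + p / 2)) < ereal c"
  then have c: "1 / (1 + p / 2) < c" by simp
  moreover have "0 < 1 / (1 + p / 2)" using \<open>0 < p\<close> by simp
  ultimately have "0 < c" by linarith
  \<comment> \<open>1 / c - 1 solves 1 / (1 + a) = c; the maximum with 0 keeps the decay exponent
    nonnegative when c > 1. It stays strictly below p / 2, and the difference is the loss \<eta>
    allowed in the decay estimate.\<close>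
  define a where "a = max 0 (1 / c - 1)"
  have a: "0 \<le> a" "a < p / 2" "1 / (1 + a) \<le> c"
    unfolding a_def using c \<open>0 < c\<close> \<open>0 < p\<close> by (auto simp: max_def field_simps)
  have "cadlag (\<lambda>_. 0 :: real ^ 'd)" unfolding cadlag_def by auto
  from AE_bounded_image[OF this, of "range (power_sequence p)"] power_sequence_in_Icc[of p] \<open>0 < p\<close>
  have bounded: "AE \<omega> in M. bounded ((\<lambda>t. B t \<omega>) ` range (power_sequence p))"
    by (auto simp del: atLeastAtMost_iff)
  have "0 < p / 2 - a" using a by simp
  from AE_power_sequence_decay[OF UNIV this, of p] bounded
  show "AE \<omega> in M. upper_minkowski_dim ((\<lambda>t. B t \<omega>) ` range (power_sequence p)) \<le> ereal c"
  proof eventually_elim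
    case (elim \<omega>)
    let ?E = "(\<lambda>t. B t \<omega>) ` range (power_sequence p)"
    obtain C where C: "0 \<le> C" "\<And>n. \<bar>B (power_sequence p n) \<omega> $ i\<bar> \<le> C * real (Suc n) powr - a"
      using elim(1) by auto
    have "upper_minkowski_dim ?E \<le> ereal (1 / (1 + a))"
    proof (rule upper_minkowski_dim_le_of_decay[where g = "\<lambda>v. v $ i" and C = C])
      show "dist v w = \<bar>v $ i - w $ i\<bar>" for v w :: "real ^ 'd"
        by (simp add: dist_vec_def UNIV dist_real_def)
      fix m :: nat assume "1 \<le> m"
      show "\<exists>G. finite G \<and> card G \<le> m \<and> (\<forall>v\<in>?E - G. \<bar>v $ i\<bar> \<le> C * real m powr - a)"
      proof (intro exI[of _ "(\<lambda>n. B (power_sequence p n) \<omega>) ` {..<m}"] conjI ballI)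
        show "card ((\<lambda>n. B (power_sequence p n) \<omega>) ` {..<m}) \<le> m"
          using card_image_le[of "{..<m}"] by simp
        fix v assume "v \<in> ?E - (\<lambda>n. B (power_sequence p n) \<omega>) ` {..<m}"
        then obtain n where n: "v = B (power_sequence p n) \<omega>" "m \<le> n" by (auto simp: not_less[symmetric])
        have "\<bar>v $ i\<bar> \<le> C * real (Suc n) powr - a" unfolding n(1) by (rule C(2))
        also have "\<dots> \<le> C * real m powr - a"
          using \<open>1 \<le> m\<close> n(2) a(1) C(1) by (intro mult_left_mono powr_mono2') auto
        finally show "\<bar>v $ i\<bar> \<le> C * real m powr - a" .
      qed simp
    qed (use elim(2) a(1) C(1) in auto)
    also have "\<dots> \<le> ereal c" using a(3) by simp
    finally show ?case .
  qed
qed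

text \<open>The endpoints 0 and 1 would need p infinite or p = 0, so a singleton and the whole
  interval stand in. Otherwise p = 1 / \<alpha> - 1 gives the sequence dimension \<alpha>.\<close>

lemma minkowski_dim_image_sharp:
  assumes d: "CARD('d) = 1" and \<alpha>: "0 \<le> \<alpha>" "\<alpha> \<le> 1"
  shows "\<exists>A. A \<noteq> {} \<and> A \<subseteq> {0..1} \<and> lower_minkowski_dim A = ereal \<alpha> \<and> upper_minkowski_dim A = ereal \<alpha> \<and>
    (AE \<omega> in M. upper_minkowski_dim ((\<lambda>t. B t \<omega>) ` A) \<le> ereal (2 * \<alpha> / (\<alpha> + 1)))"
proof -
  obtain i where UNIV: "(UNIV :: 'd set) = {i}" using d card_1_singletonE by blast
  consider "\<alpha> = 0" | "\<alpha> = 1" | "0 < \<alpha>" "\<alpha> < 1" using \<alpha> by linarith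
  then show ?thesis
  proof cases
    case 1
    then show ?thesis
      by (intro exI[of _ "{0}"]) (simp add: minkowski_dim_singleton)
  next
    case 2
    have "cadlag (\<lambda>_. 0 :: real ^ 'd)" unfolding cadlag_def by auto
    from AE_bounded_image[OF this order_refl]
    have "AE \<omega> in M. upper_minkowski_dim ((\<lambda>t. B t \<omega>) ` {0..1}) \<le> 1"
    proof eventually_elim
      case (elim \<omega>)
      show ?case
        by (rule upper_minkowski_dim_le_1[of "\<lambda>v. v $ i"])
           (use elim in \<open>auto simp: dist_vec_def UNIV dist_real_def\<close>)
    qed
    then show ?thesis using 2
      by (intro exI[of _ "{0..1}"]) (simp add: minkowski_dim_unit_interval one_ereal_def[symmetric])
  next
    case 3
    define p where "p = 1 / \<alpha> - 1"
    have "0 < p" unfolding p_def using 3 by simp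
    have dims: "1 / (1 + p) = \<alpha>" "1 / (1 + p / 2) = 2 * \<alpha> / (\<alpha> + 1)"
      unfolding p_def using 3 by (auto simp: field_simps)
    have "range (power_sequence p) \<subseteq> {0..1}"
      using power_sequence_in_Icc[of p] \<open>0 < p\<close> by (auto simp del: atLeastAtMost_iff)
    then show ?thesis
      using minkowski_dim_power_sequence[OF \<open>0 < p\<close>]
        AE_upper_minkowski_dim_image_power_sequence_le[OF UNIV \<open>0 < p\<close>]
      unfolding dims by (intro exI[of _ "range (power_sequence p)"]) auto
  qed
qed

end

theorem corollary1p5:
  fixes M :: "'w measure" and B :: "real \<Rightarrow> 'w \<Rightarrow> real ^ 'd"
  assumes "standard_brownian_motion M B"
  shows
    "(CARD('d) = 1 \<longrightarrow>
       (\<forall>f :: real \<Rightarrow> real ^ 'd. cadlag f \<longrightarrow>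
          (\<forall>A :: real set. A \<noteq> {} \<longrightarrow> A \<subseteq> {0..1} \<longrightarrow>
            (AE \<omega> in M.
               lower_minkowski_dim ((\<lambda>t. B t \<omega> + f t) ` A)
                 \<ge> 2 * lower_minkowski_dim A / (lower_minkowski_dim A + 1) \<and>
               upper_minkowski_dim ((\<lambda>t. B t \<omega> + f t) ` A)
                 \<ge> 2 * upper_minkowski_dim A / (upper_minkowski_dim A + 1)))) \<and>
       (\<forall>\<alpha>::real. 0 \<le> \<alpha> \<longrightarrow> \<alpha> \<le> 1 \<longrightarrow>
          (\<exists>(f :: real \<Rightarrow> real ^ 'd) A. cadlag f \<and> A \<noteq> {} \<and> A \<subseteq> {0..1} \<and>
             lower_minkowski_dim A = ereal \<alpha> \<and> upper_minkowski_dim A = ereal \<alpha> \<and>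
             (AE \<omega> in M.
                lower_minkowski_dim ((\<lambda>t. B t \<omega> + f t) ` A)
                  = 2 * lower_minkowski_dim A / (lower_minkowski_dim A + 1) \<and>
                upper_minkowski_dim ((\<lambda>t. B t \<omega> + f t) ` A)
                  = 2 * upper_minkowski_dim A / (upper_minkowski_dim A + 1))))) \<and>
     (CARD('d) \<ge> 2 \<longrightarrow>
       (\<forall>f :: real \<Rightarrow> real ^ 'd. cadlag f \<longrightarrow>
          (\<forall>A :: real set. A \<noteq> {} \<longrightarrow> A \<subseteq> {0..1} \<longrightarrow>
            (AE \<omega> in M.
               lower_minkowski_dim ((\<lambda>t. B t \<omega> + f t) ` A) \<ge> 2 * lower_minkowski_dim A \<and>
               upper_minkowski_dim ((\<lambda>t. B t \<omega> + f t) ` A) \<ge> 2 * upper_minkowski_dim A))))"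
proof -
  interpret standard_brownian_motion M B by fact
  show ?thesis
  proof (intro conjI impI allI)
    fix f :: "real \<Rightarrow> real ^ 'd" and A :: "real set"
    assume *: "cadlag f" "A \<noteq> {}" "A \<subseteq> {0..1}"
    show "AE \<omega> in M. lower_minkowski_dim ((\<lambda>t. B t \<omega> + f t) ` A)
          \<ge> 2 * lower_minkowski_dim A / (lower_minkowski_dim A + 1) \<and>
        upper_minkowski_dim ((\<lambda>t. B t \<omega> + f t) ` A)
          \<ge> 2 * upper_minkowski_dim A / (upper_minkowski_dim A + 1)"
      using AE_minkowski_dim_image_ge_dim1[OF *(1,3,2)] by (rule AE_conjI)
    assume "CARD('d) \<ge> 2"
    then show "AE \<omega> in M. lower_minkowski_dim ((\<lambda>t. B t \<omega> + f t) ` A) \<ge> 2 * lower_minkowski_dim A \<and>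
        upper_minkowski_dim ((\<lambda>t. B t \<omega> + f t) ` A) \<ge> 2 * upper_minkowski_dim A"
      using AE_minkowski_dim_image_ge_dim2[OF *(1,3,2)] by (intro AE_conjI)
  next
    fix \<alpha> :: real
    assume "CARD('d) = 1" "0 \<le> \<alpha>" "\<alpha> \<le> 1"
    from minkowski_dim_image_sharp[OF this]
    obtain A where A: "A \<noteq> {}" "A \<subseteq> {0..1}" "lower_minkowski_dim A = ereal \<alpha>" "upper_minkowski_dim A = ereal \<alpha>"
      and upper: "AE \<omega> in M. upper_minkowski_dim ((\<lambda>t. B t \<omega>) ` A) \<le> ereal (2 * \<alpha> / (\<alpha> + 1))"
      by blast
    have 0: "cadlag (\<lambda>_. 0 :: real ^ 'd)" unfolding cadlag_def by auto
    have "2 * ereal \<alpha> / (ereal \<alpha> + 1) = ereal (2 * \<alpha> / (\<alpha> + 1))"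
      using \<open>0 \<le> \<alpha>\<close> by (simp add: one_ereal_def)
    with AE_minkowski_dim_image_ge_dim1[OF 0 A(2,1)] A(3,4)
    have lower: "AE \<omega> in M. ereal (2 * \<alpha> / (\<alpha> + 1)) \<le> lower_minkowski_dim ((\<lambda>t. B t \<omega>) ` A)"
      by simp
    \<comment> \<open>The general lower bound on the lower dimension and the upper bound on the
      upper dimension coincide, which pins down both.\<close>
    have "AE \<omega> in M. lower_minkowski_dim ((\<lambda>t. B t \<omega> + 0) ` A) = ereal (2 * \<alpha> / (\<alpha> + 1)) \<and>
        upper_minkowski_dim ((\<lambda>t. B t \<omega> + 0) ` A) = ereal (2 * \<alpha> / (\<alpha> + 1))"
      using lower upper
    proof eventually_elim
      case (elim \<omega>)
      then show ?case using lower_minkowski_dim_le_upper[of "(\<lambda>t. B t \<omega>) ` A"] by auto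
    qed
    then show "\<exists>(f :: real \<Rightarrow> real ^ 'd) A. cadlag f \<and> A \<noteq> {} \<and> A \<subseteq> {0..1} \<and>
             lower_minkowski_dim A = ereal \<alpha> \<and> upper_minkowski_dim A = ereal \<alpha> \<and>
             (AE \<omega> in M.
                lower_minkowski_dim ((\<lambda>t. B t \<omega> + f t) ` A)
                  = 2 * lower_minkowski_dim A / (lower_minkowski_dim A + 1) \<and>
                upper_minkowski_dim ((\<lambda>t. B t \<omega> + f t) ` A)
                  = 2 * upper_minkowski_dim A / (upper_minkowski_dim A + 1))"
      using 0 A \<open>2 * ereal \<alpha> / (ereal \<alpha> + 1) = ereal (2 * \<alpha> / (\<alpha> + 1))\<close>
      by (intro exI[of _ "\<lambda>_. 0"] exI[of _ A]) simp
  qed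
qed

end
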